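(* Suppose there is an algorithm solving the All-Edges Monochromatic Triangle problem (\textsf{AE-Mono}$\Delta$) on $n$-node graphs in time $T(n)$. Then the Minimum Witness matrix product (\textsf{MinWitness}) of two $n\times n$ Boolean matrices can be computed in $O(T(n)\log n)$ time.
   Context: All-Edges Monochromatic Triangle (\textsf{AE-Mono}$\Delta$): given an $n$-node graph $G$ in which each edge has a color from $\{1,\dots,n^2\}$, decide for each edge whether it belongs to a monochromatic triangle, i.e. a triangle all three of whose edges have the same color. Minimum Witness product (\textsf{MinWitness}): given two $n\times n$ Boolean matrices $A,B$, compute the matrix $C$ with $C_{ij}=\min(\{k \mid A_{ik}=B_{kj}=1\}\cup\{\infty\})$. Running times are measured in the word-RAM model with $O(\log n)$-bit words. *)

theory Defs
  imports Complex_Main "HOL-Library.Landau_Symbols" "HOL-Library.Extended_Nat"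
begin

section \<open>Word RAM\<close>

text \<open>
  A program is a fixed finite list of instructions. The machine has registers, addressed only by
  constants occurring in the program, and a memory addressed by words. Words of length \<open>w\<close> are
  the natural numbers below \<open>2 ^ w\<close>, and arithmetic wraps around modulo \<open>2 ^ w\<close>.
\<close>

datatype binop = Add | Sub | Mul | Div | Mod | And | Or | Xor | Shl | Shr

datatype instr =
    Const nat nat
  | Op binop nat nat nat
  | Load nat nat
  | Store nat nat
  | JmpEq nat nat nat
  | JmpLess nat nat nat

type_synonym program = "instr list"

datatype config = Config (pc: nat) (regs: "nat \<Rightarrow> nat") (mem: "nat \<Rightarrow> nat")

text \<open>As in HOL, division by zero yields zero, and the remainder modulo zero is the dividend.\<close>

fun binop_val :: "binop \<Rightarrow> nat \<Rightarrow> nat \<Rightarrow> int" where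
  "binop_val Add x y = int x + int y"
| "binop_val Sub x y = int x - int y"
| "binop_val Mul x y = int x * int y"
| "binop_val Div x y = int (x div y)"
| "binop_val Mod x y = int (x mod y)"
| "binop_val And x y = int (Bit_Operations.and x y)"
| "binop_val Or x y = int (Bit_Operations.or x y)"
| "binop_val Xor x y = int (Bit_Operations.xor x y)"
| "binop_val Shl x y = int (push_bit y x)"
| "binop_val Shr x y = int (drop_bit y x)"

fun exec :: "nat \<Rightarrow> instr \<Rightarrow> config \<Rightarrow> config" where
  "exec w (Const d k) (Config p r m) = Config (p + 1) (r(d := k mod 2 ^ w)) m"
| "exec w (Op b d s t) (Config p r m) =
     Config (p + 1) (r(d := nat (binop_val b (r s) (r t) mod 2 ^ w))) m"
| "exec w (Load d s) (Config p r m) = Config (p + 1) (r(d := m (r s))) m"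
| "exec w (Store d s) (Config p r m) = Config (p + 1) r (m(r d := r s))"
| "exec w (JmpEq s t l) (Config p r m) = Config (if r s = r t then l else p + 1) r m"
| "exec w (JmpLess s t l) (Config p r m) = Config (if r s < r t then l else p + 1) r m"

text \<open>The machine halts when control leaves the program.\<close>

definition halted :: "program \<Rightarrow> config \<Rightarrow> bool" where
  "halted P c \<longleftrightarrow> length P \<le> pc c"

definition step :: "nat \<Rightarrow> program \<Rightarrow> config \<Rightarrow> config" where
  "step w P c = (if halted P c then c else exec w (P ! pc c) c)"

text \<open>
  Initially register 0 holds the size parameter \<open>n\<close>, the input words occupy the memory from
  address 0 on, and everything else is zero.
\<close>

definition init :: "nat \<Rightarrow> nat list \<Rightarrow> config" where
  "init n xs = Config 0 ((\<lambda>_. 0)(0 := n)) (\<lambda>a. if a < length xs then xs ! a else 0)"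

definition input_fits :: "nat \<Rightarrow> nat \<Rightarrow> nat list \<Rightarrow> bool" where
  "input_fits w n xs \<longleftrightarrow> n < 2 ^ w \<and> length xs \<le> 2 ^ w \<and> (\<forall>x\<in>set xs. x < 2 ^ w)"

text \<open>Each instruction takes one unit of time; \<open>Q\<close> is a condition on the final memory.\<close>

definition run_within ::
  "nat \<Rightarrow> program \<Rightarrow> nat \<Rightarrow> nat list \<Rightarrow> real \<Rightarrow> ((nat \<Rightarrow> nat) \<Rightarrow> bool) \<Rightarrow> bool" where
  "run_within w P n xs t Q \<longleftrightarrow> input_fits w n xs \<and>
     (\<exists>k. real k \<le> t \<and> halted P ((step w P ^^ k) (init n xs)) \<and>
          Q (mem ((step w P ^^ k) (init n xs))))"

text \<open>
  Words of \<open>O(log n)\<close> bits: the constant factor \<open>c\<close> may be chosen by the algorithm. The summand 2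
  keeps the word length positive for every \<open>c > 0\<close>.
\<close>

definition word_length :: "nat \<Rightarrow> nat \<Rightarrow> nat" where
  "word_length c n = c * nat \<lceil>log 2 (real n + 2)\<rceil>"

definition row_major :: "nat \<Rightarrow> (nat \<Rightarrow> nat \<Rightarrow> nat) \<Rightarrow> nat list" where
  "row_major n f = map (\<lambda>a. f (a div n) (a mod n)) [0..<n * n]"


section \<open>All-Edges Monochromatic Triangle\<close>

definition edge_colored_graph :: "nat \<Rightarrow> nat set set \<Rightarrow> (nat set \<Rightarrow> nat) \<Rightarrow> bool" where
  "edge_colored_graph n E col \<longleftrightarrow>
     (\<forall>e\<in>E. e \<subseteq> {..<n} \<and> card e = 2) \<and> (\<forall>e\<in>E. col e \<in> {1..n ^ 2})"

definition in_mono_triangle :: "nat set set \<Rightarrow> (nat set \<Rightarrow> nat) \<Rightarrow> nat set \<Rightarrow> bool" where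
  "in_mono_triangle E col e \<longleftrightarrow>
     (\<exists>u v x. distinct [u, v, x] \<and> e = {u, v} \<and> {u, v} \<in> E \<and> {v, x} \<in> E \<and> {u, x} \<in> E \<and>
              col {u, v} = col {v, x} \<and> col {v, x} = col {u, x})"

text \<open>Colors are positive, so 0 marks a non-edge in the color matrix.\<close>

definition graph_input :: "nat \<Rightarrow> nat set set \<Rightarrow> (nat set \<Rightarrow> nat) \<Rightarrow> nat list" where
  "graph_input n E col = row_major n (\<lambda>u v. if {u, v} \<in> E then col {u, v} else 0)"

text \<open>The output cells of non-edges may hold arbitrary words.\<close>

definition AE_Mono_Triangle_in_time :: "(nat \<Rightarrow> real) \<Rightarrow> bool" where
  "AE_Mono_Triangle_in_time T \<longleftrightarrow>
     (\<exists>P c. \<forall>n>0. \<forall>E col. edge_colored_graph n E col \<longrightarrow>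
        run_within (word_length c n) P n (graph_input n E col) (T n)
          (\<lambda>m. \<forall>u<n. \<forall>v<n. {u, v} \<in> E \<longrightarrow>
                 m (u * n + v) = (if in_mono_triangle E col {u, v} then 1 else 0)))"


section \<open>Minimum Witness product\<close>

text \<open>Boolean matrices of dimension \<open>n\<close> are indexed by \<open>{..<n}\<close>.\<close>

definition min_witness ::
  "nat \<Rightarrow> (nat \<Rightarrow> nat \<Rightarrow> bool) \<Rightarrow> (nat \<Rightarrow> nat \<Rightarrow> bool) \<Rightarrow> nat \<Rightarrow> nat \<Rightarrow> enat" where
  "min_witness n A B i j = Min ({enat k | k. k < n \<and> A i k \<and> B k j} \<union> {\<infinity>})"

text \<open>Witnesses are smaller than \<open>n\<close>, so the word \<open>n\<close> represents \<open>\<infinity>\<close>.\<close>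

definition witness_word :: "nat \<Rightarrow> enat \<Rightarrow> nat" where
  "witness_word n x = (case x of enat k \<Rightarrow> k | \<infinity> \<Rightarrow> n)"

definition matrices_input ::
  "nat \<Rightarrow> (nat \<Rightarrow> nat \<Rightarrow> bool) \<Rightarrow> (nat \<Rightarrow> nat \<Rightarrow> bool) \<Rightarrow> nat list" where
  "matrices_input n A B =
     row_major n (\<lambda>i k. of_bool (A i k)) @ row_major n (\<lambda>k j. of_bool (B k j))"

definition MinWitness_in_time :: "(nat \<Rightarrow> real) \<Rightarrow> bool" where
  "MinWitness_in_time T \<longleftrightarrow>
     (\<exists>P c. \<forall>n>0. \<forall>A B.
        run_within (word_length c n) P n (matrices_input n A B) (T n)
          (\<lambda>m. \<forall>i<n. \<forall>j<n. m (i * n + j) = witness_word n (min_witness n A B i j)))"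

end

theory Submission
  imports Defs
begin

text \<open>
  All entries of the product are found by a simultaneous binary search. If \<open>q i j\<close> is the number of
  the interval of length \<open>p\<close> that is tested for the entry \<open>(i, j)\<close>, then the edge between row \<open>i\<close>
  and column \<open>j\<close> gets the color \<open>q i j + 1\<close>, and the edges from a witness \<open>k\<close> get the color
  \<open>k div p + 1\<close>. Hence the edge \<open>(i, j)\<close> is in a monochromatic triangle if and only if the interval
  contains a witness, and halving \<open>p\<close> takes \<open>O(log n)\<close> rounds.

  Nothing is known about the growth of \<open>T\<close>, so the algorithm must only be called on graphs with
  exactly \<open>n\<close> nodes, although the tripartite graph has \<open>3 * n\<close> nodes. Therefore rows, columns and
  witnesses are cut into at most five blocks of \<open>n div 3\<close> indices, and each round makes 125 calls,
  one for each triple of blocks. For \<open>n < 3\<close>, graphs with three nodes are used.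

  A call may leave arbitrary words in its memory. Instead of cleaning up, each call uses a new part
  of the memory, which is still zero; this is affordable because the word length of the reduction
  may exceed that of the given algorithm by a constant factor. The \<open>O(n\<^sup>2)\<close> overhead of a call is
  dominated by \<open>T n\<close>: if all edges of the complete graph have color 2, then the algorithm must
  change all \<open>n * (n - 1)\<close> cells of the edges to 0 or 1.
\<close>

section \<open>Structured programs and their compilation\<close>

text \<open>The given program cannot be spliced into the reduction: its addresses start at 0, it
  halts by leaving its own code, and its arithmetic wraps at \<open>2 ^ v\<close> for its own word
  length \<open>v\<close>. It is interpreted instruction by instruction instead, which costs only a
  constant factor because its length is fixed. Registers are addressed by constants, so those of the
  interpreted program can be a fixed finite range of registers of the reduction. A time bound gives
  no usable bound on the addresses that are touched; only the word length does, so a call needs a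
  window of \<open>2 ^ v\<close> cells.

  The 125 answers of a round need no merging. Every entry is first set to the second half of its
  interval, and a call that finds a witness in the first half merely clears the last bit, which can
  happen in any order and any number of times.

  Loop invariants are awkward for code with jumps. The reduction is therefore written in a
  structured language whose big-step semantics counts time, and is compiled once and for
  all.\<close>

datatype cmp = Less | Equal

fun holds :: "cmp \<Rightarrow> nat \<Rightarrow> nat \<Rightarrow> bool" where
  "holds Less x y \<longleftrightarrow> x < y"
| "holds Equal x y \<longleftrightarrow> x = y"

fun jump :: "cmp \<Rightarrow> nat \<Rightarrow> nat \<Rightarrow> nat \<Rightarrow> instr" where
  "jump Less s t l = JmpLess s t l"
| "jump Equal s t l = JmpEq s t l"

text \<open>Expressions include \<open>Cond\<close> so that a matrix entry with all its case
  distinctions is a single expression, which can be a parameter of the loop that fills a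
  matrix.\<close>

datatype exp =
    Num nat
  | Reg nat
  | Bin binop exp exp
  | Mem exp
  | Cond cmp exp exp exp exp

datatype com =
    Assign nat exp
  | Write exp exp
  | Seq com com
  | Test cmp exp exp com com
  | While cmp exp exp com

fun eval :: "nat \<Rightarrow> (nat \<Rightarrow> nat) \<Rightarrow> (nat \<Rightarrow> nat) \<Rightarrow> exp \<Rightarrow> nat" where
  "eval w r m (Num k) = k mod 2 ^ w"
| "eval w r m (Reg x) = r x"
| "eval w r m (Bin b e f) = nat (binop_val b (eval w r m e) (eval w r m f) mod 2 ^ w)"
| "eval w r m (Mem e) = m (eval w r m e)"
| "eval w r m (Cond c e f g h) =
     (if holds c (eval w r m e) (eval w r m f) then eval w r m g else eval w r m h)"


text \<open>The code of an expression has only forward jumps, so its length also bounds its running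
  time.\<close>

fun elen :: "exp \<Rightarrow> nat" where
  "elen (Num k) = 1"
| "elen (Reg x) = 1"
| "elen (Bin b e f) = elen e + elen f + 1"
| "elen (Mem e) = elen e + 1"
| "elen (Cond c e f g h) = elen e + elen f + elen g + elen h + 2"

fun clen :: "com \<Rightarrow> nat" where
  "clen (Assign x e) = elen e + 1"
| "clen (Write e f) = elen e + elen f + 1"
| "clen (Seq a b) = clen a + clen b"
| "clen (Test c e f a b) = elen e + elen f + clen a + clen b + 2"
| "clen (While c e f a) = elen e + elen f + clen a + 3"

text \<open>The cost is an upper bound on the number of executed instructions, not an exact count:
  \<open>elen\<close> charges both branches of a \<open>Cond\<close>, and the numerals are rounded
  up to be uniform.\<close>

inductive runs :: "nat \<Rightarrow> com \<Rightarrow> nat \<Rightarrow> (nat \<Rightarrow> nat) \<times> (nat \<Rightarrow> nat) \<Rightarrow>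
    (nat \<Rightarrow> nat) \<times> (nat \<Rightarrow> nat) \<Rightarrow> bool" for w where
  Assign: "runs w (Assign x e) (elen e + 1) (r, m) (r(x := eval w r m e), m)"
| Write: "runs w (Write e f) (elen e + elen f + 1) (r, m) (r, m(eval w r m e := eval w r m f))"
| Seq: "runs w a t s s' \<Longrightarrow> runs w b u s' s'' \<Longrightarrow> runs w (Seq a b) (t + u) s s''"
| TestT: "holds c (eval w r m e) (eval w r m f) \<Longrightarrow> runs w a t (r, m) s \<Longrightarrow>
    runs w (Test c e f a b) (elen e + elen f + t + 2) (r, m) s"
| TestF: "\<not> holds c (eval w r m e) (eval w r m f) \<Longrightarrow> runs w b t (r, m) s \<Longrightarrow>
    runs w (Test c e f a b) (elen e + elen f + t + 2) (r, m) s"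
| WhileF: "\<not> holds c (eval w r m e) (eval w r m f) \<Longrightarrow>
    runs w (While c e f a) (elen e + elen f + 3) (r, m) (r, m)"
| WhileT: "holds c (eval w r m e) (eval w r m f) \<Longrightarrow> runs w a t (r, m) s \<Longrightarrow>
    runs w (While c e f a) u s s' \<Longrightarrow>
    runs w (While c e f a) (elen e + elen f + 3 + t + u) (r, m) s'"

fun evars :: "exp \<Rightarrow> nat set" where
  "evars (Num k) = {}"
| "evars (Reg x) = {x}"
| "evars (Bin b e f) = evars e \<union> evars f"
| "evars (Mem e) = evars e"
| "evars (Cond c e f g h) = evars e \<union> evars f \<union> evars g \<union> evars h"

fun cvars :: "com \<Rightarrow> nat set" where
  "cvars (Assign x e) = insert x (evars e)"
| "cvars (Write e f) = evars e \<union> evars f"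
| "cvars (Seq a b) = cvars a \<union> cvars b"
| "cvars (Test c e f a b) = evars e \<union> evars f \<union> cvars a \<union> cvars b"
| "cvars (While c e f a) = evars e \<union> evars f \<union> cvars a"

text \<open>
  The arguments \<open>d\<close> and \<open>p\<close> are the first free register and the position of the code. The value of
  an expression is left in register \<open>d\<close>. A disjunction of a word with itself copies a register.
\<close>

fun ecode :: "nat \<Rightarrow> nat \<Rightarrow> exp \<Rightarrow> instr list" where
  "ecode d p (Num k) = [Const d k]"
| "ecode d p (Reg x) = [Op Or d x x]"
| "ecode d p (Bin b e f) = ecode d p e @ ecode (d + 1) (p + elen e) f @ [Op b d d (d + 1)]"
| "ecode d p (Mem e) = ecode d p e @ [Load d d]"
| "ecode d p (Cond c e f g h) =
     (let q = p + elen e + elen f; q' = q + 1 + elen h + 1; q'' = q' + elen g in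
      ecode d p e @ ecode (d + 1) (p + elen e) f @ jump c d (d + 1) q' #
      ecode d (q + 1) h @ JmpEq d d q'' # ecode d q' g)"

fun ccode :: "nat \<Rightarrow> nat \<Rightarrow> com \<Rightarrow> instr list" where
  "ccode d p (Assign x e) = ecode d p e @ [Op Or x d d]"
| "ccode d p (Write e f) = ecode d p e @ ecode (d + 1) (p + elen e) f @ [Store d (d + 1)]"
| "ccode d p (Seq a b) = ccode d p a @ ccode d (p + clen a) b"
| "ccode d p (Test c e f a b) =
     (let q = p + elen e + elen f; q' = q + 1 + clen b + 1; q'' = q' + clen a in
      ecode d p e @ ecode (d + 1) (p + elen e) f @ jump c d (d + 1) q' #
      ccode d (q + 1) b @ JmpEq d d q'' # ccode d q' a)"
| "ccode d p (While c e f a) =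
     (let q = p + elen e + elen f; q' = q + 2 + clen a + 1 in
      ecode d p e @ ecode (d + 1) (p + elen e) f @ jump c d (d + 1) (q + 2) #
      JmpEq d d q' # ccode d (q + 2) a @ [JmpEq d d p])"

lemma length_ecode [simp]: "length (ecode d p e) = elen e"
  by (induction d p e rule: ecode.induct) (auto simp: Let_def)

lemma length_ccode [simp]: "length (ccode d p a) = clen a"
  by (induction d p a rule: ccode.induct) (auto simp: Let_def)

section \<open>Correctness of the compilation\<close>

definition code_at :: "program \<Rightarrow> nat \<Rightarrow> instr list \<Rightarrow> bool" where
  "code_at P p is \<longleftrightarrow> (\<exists>xs ys. P = xs @ is @ ys \<and> length xs = p)"

lemma code_at_append [simp]:
  "code_at P p (is @ js) \<longleftrightarrow> code_at P p is \<and> code_at P (p + length is) js"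
  (is "?l \<longleftrightarrow> ?r")
proof
  assume ?l
  then show ?r
    unfolding code_at_def by (metis append.assoc length_append)
next
  assume ?r
  then obtain xs ys xs' ys' where P: "P = xs @ is @ ys" "length xs = p"
    "P = xs' @ js @ ys'" "length xs' = p + length is"
    unfolding code_at_def by blast
  then have "xs' = xs @ is"
    by (metis append.assoc append_eq_append_conv length_append)
  with P show ?l
    unfolding code_at_def by auto
qed

lemma code_at_Cons:
  "code_at P p (i # js) \<longleftrightarrow> code_at P p [i] \<and> code_at P (p + 1) js"
  using code_at_append [of P p "[i]" js] by simp

lemma code_at_singleton: "code_at P p [i] \<Longrightarrow> p < length P \<and> P ! p = i"
  unfolding code_at_def by auto

definition reach :: "nat \<Rightarrow> program \<Rightarrow> nat \<Rightarrow> config \<Rightarrow> config \<Rightarrow> bool" where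
  "reach w P t c c' \<longleftrightarrow> (\<exists>k\<le>t. (step w P ^^ k) c = c')"

lemma reach_trans:
  assumes "reach w P t c c'" "reach w P u c' c''" "t + u \<le> v"
  shows "reach w P v c c''"
proof -
  obtain k l where "k \<le> t" "l \<le> u" "(step w P ^^ k) c = c'" "(step w P ^^ l) c' = c''"
    using assms unfolding reach_def by blast
  then have "(step w P ^^ (l + k)) c = c''" "l + k \<le> v"
    using assms(3) by (simp_all add: funpow_add)
  then show ?thesis
    unfolding reach_def by blast
qed

lemma reach_exec:
  assumes "code_at P (pc c) [i]"
  shows "reach w P 1 c (exec w i c)"
  using code_at_singleton [OF assms] unfolding reach_def
  by (intro exI [of _ 1]) (simp add: step_def halted_def)

definition words :: "nat \<Rightarrow> (nat \<Rightarrow> nat) \<Rightarrow> bool" where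
  "words w f \<longleftrightarrow> (\<forall>x. f x < 2 ^ w)"

lemma words_upd: "words w f \<Longrightarrow> y < 2 ^ w \<Longrightarrow> words w (f(x := y))"
  unfolding words_def by simp

lemma nat_mod_less: "nat (k mod 2 ^ w) < 2 ^ w"
  by (simp add: nat_less_iff)

lemma eval_cong: "(\<And>x. x \<in> evars e \<Longrightarrow> r x = r' x) \<Longrightarrow> eval w r m e = eval w r' m e"
  by (induction e) auto

lemma exec_jump:
  "exec w (jump c s t l) (Config p r m) = Config (if holds c (r s) (r t) then l else p + 1) r m"
  by (cases c) auto

text \<open>The copy is reduced modulo \<open>2 ^ w\<close>, so it is faithful only for a register
  that holds a word. Hence \<open>words\<close> is carried through the proofs about the compiler,
  for the memory as well because of \<open>Load\<close>.\<close>

lemma exec_move: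
  "words w r \<Longrightarrow> exec w (Op Or x y y) (Config p r m) = Config (p + 1) (r(x := r y)) m"
  by (simp add: words_def nat_mod_distrib)

text \<open>Registers from \<open>d\<close> on are scratch space of the compiled code, so states are
  compared only below \<open>d\<close>.\<close>

definition same :: "nat \<Rightarrow> (nat \<Rightarrow> nat) \<Rightarrow> (nat \<Rightarrow> nat) \<Rightarrow> bool" where
  "same d r r' \<longleftrightarrow> (\<forall>x<d. r x = r' x)"

lemma eval_same: "same d r r' \<Longrightarrow> evars e \<subseteq> {..<d} \<Longrightarrow> eval w r m e = eval w r' m e"
  by (rule eval_cong) (auto simp: same_def)

lemma same_upd [simp]: "d \<le> x \<Longrightarrow> same d r r' \<Longrightarrow> same d r (r'(x := v))"
  by (simp add: same_def)

lemma same_refl [simp]: "same d r r"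
  by (simp add: same_def)

text \<open>The induction generalizes \<open>d\<close>: the second operand is compiled with
  \<open>d + 1\<close>, and preservation below \<open>d + 1\<close> protects the first operand in
  register \<open>d\<close>.\<close>

lemma ecode_correct:
  assumes "code_at P p (ecode d p e)" "evars e \<subseteq> {..<d}" "words w r" "words w m"
  shows "\<exists>r'. reach w P (elen e) (Config p r m) (Config (p + elen e) r' m) \<and>
    r' d = eval w r m e \<and> same d r r' \<and> words w r'"
  using assms
proof (induction e arbitrary: p d r)
  case (Num k)
  show ?case
    using reach_exec [of P "Config p r m" "Const d k" w] Num
    by (intro exI [of _ "r(d := k mod 2 ^ w)"]) (simp add: words_upd fun_upd_same del: fun_upd_apply)
next
  case (Reg x)
  have "r x < 2 ^ w"
    using Reg by (auto simp: words_def)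
  then show ?case
    using reach_exec [of P "Config p r m" "Op Or d x x" w] Reg exec_move[of w r d x p m]
    by (intro exI [of _ "r(d := r x)"]) (simp add: words_upd fun_upd_same del: exec.simps fun_upd_apply)
next
  case (Bin b e f)
  obtain r1 where r1: "reach w P (elen e) (Config p r m) (Config (p + elen e) r1 m)"
    "r1 d = eval w r m e" "same d r r1" "words w r1"
    using Bin.IH(1) [of p d r] Bin.prems by auto
  obtain r2 where r2: "reach w P (elen f) (Config (p + elen e) r1 m) (Config (p + elen e + elen f) r2 m)"
    "r2 (d + 1) = eval w r1 m f" "same (d + 1) r1 r2" "words w r2"
    using Bin.IH(2) [of "p + elen e" "d + 1" r1] Bin.prems r1 by (auto simp: lessThan_Suc)
  have f: "eval w r1 m f = eval w r m f"
    using eval_same [OF r1(3)] Bin.prems by simp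
  let ?c = "Config (p + elen e + elen f) r2 m"
  have "reach w P 1 ?c (exec w (Op b d d (d + 1)) ?c)"
    using Bin.prems by (intro reach_exec) (simp add: add.assoc)
  then have "reach w P (elen (Bin b e f)) (Config p r m) (exec w (Op b d d (d + 1)) ?c)"
    using reach_trans [OF reach_trans [OF r1(1) r2(1) order_refl]] by simp
  moreover have "r2 d = eval w r m e" "same d r r2"
    using r1(2,3) r2(3) by (simp_all add: same_def)
  ultimately show ?case
    using r2 f
    by (intro exI [of _ "r2(d := eval w r m (Bin b e f))"])
       (simp add: nat_mod_less add.assoc words_upd fun_upd_same del: fun_upd_apply)
next
  case (Mem e)
  obtain r1 where r1: "reach w P (elen e) (Config p r m) (Config (p + elen e) r1 m)"
    "r1 d = eval w r m e" "same d r r1" "words w r1"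
    using Mem.IH [of p d r] Mem.prems by auto
  let ?c = "Config (p + elen e) r1 m"
  have "reach w P 1 ?c (exec w (Load d d) ?c)"
    using Mem.prems by (intro reach_exec) simp
  then have "reach w P (elen (Mem e)) (Config p r m) (exec w (Load d d) ?c)"
    using reach_trans [OF r1(1)] by simp
  then show ?case
    using r1 Mem.prems
    by (intro exI [of _ "r1(d := m (r1 d))"]) (simp add: words_upd fun_upd_same words_def [of w m] del: fun_upd_apply)
next
  case (Cond c e f g h)
  define q where "q = p + elen e + elen f"
  define q' where "q' = q + 1 + elen h + 1"
  have code: "code_at P p (ecode d p e)" "code_at P (p + elen e) (ecode (d + 1) (p + elen e) f)"
    "code_at P q [jump c d (d + 1) q']" "code_at P (q + 1) (ecode d (q + 1) h)"
    "code_at P (q + 1 + elen h) [JmpEq d d (q' + elen g)]" "code_at P q' (ecode d q' g)"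
    using Cond.prems(1)
    by (auto simp: q_def q'_def Let_def add.assoc code_at_Cons [where i = "jump _ _ _ _" and js = "_ @ _"]
        code_at_Cons [where i = "JmpEq _ _ _" and js = "ecode _ _ _"])
  obtain r1 where r1: "reach w P (elen e) (Config p r m) (Config (p + elen e) r1 m)"
    "r1 d = eval w r m e" "same d r r1" "words w r1"
    using Cond.IH(1) [of p d r] code Cond.prems(2-4) by auto
  obtain r2 where r2: "reach w P (elen f) (Config (p + elen e) r1 m) (Config q r2 m)"
    "r2 (d + 1) = eval w r1 m f" "same (d + 1) r1 r2" "words w r2"
    using Cond.IH(2) [of "p + elen e" "d + 1" r1] Cond.prems(2-4) r1 code
    by (auto simp: q_def lessThan_Suc)
  have f: "eval w r1 m f = eval w r m f"
    using eval_same [OF r1(3)] Cond.prems by simp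
  have e: "r2 d = eval w r m e"
    using r1(2) r2(3) by (simp add: same_def)
  have same2: "same d r r2"
    using r1 r2 by (auto simp: same_def)
  have g: "eval w r2 m g = eval w r m g" "eval w r2 m h = eval w r m h"
    using eval_same [OF same2, of g w m] eval_same [OF same2, of h w m] Cond.prems by auto
  let ?t = "holds c (eval w r m e) (eval w r m f)"
  let ?c = "Config q r2 m"
  have j: "reach w P (elen e + elen f + 1) (Config p r m)
      (Config (if ?t then q' else q + 1) r2 m)"
    using reach_exec [of P ?c "jump c d (d + 1) q'" w] code(3) e r2(2) f
      reach_trans [OF reach_trans [OF r1(1) r2(1) order_refl]]
    by (simp add: exec_jump del: jump.simps)
  show ?case
  proof (cases ?t)
    case True
    obtain r3 where r3: "reach w P (elen g) (Config q' r2 m) (Config (q' + elen g) r3 m)"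
      "r3 d = eval w r2 m g" "same d r2 r3" "words w r3"
      using Cond.IH(3) [of q' d r2] Cond.prems(2-4) code r2 by auto
    have "reach w P (elen (Cond c e f g h)) (Config p r m) (Config (q' + elen g) r3 m)"
      using reach_trans [OF j [unfolded if_P [OF True]] r3(1)] by simp
    then show ?thesis
      using r3 True g same2 by (intro exI [of _ r3]) (auto simp: same_def q'_def q_def add_ac)
  next
    case False
    obtain r3 where r3: "reach w P (elen h) (Config (q + 1) r2 m) (Config (q + 1 + elen h) r3 m)"
      "r3 d = eval w r2 m h" "same d r2 r3" "words w r3"
      using Cond.IH(4) [of "q + 1" d r2] Cond.prems(2-4) code r2 by auto
    let ?c = "Config (q + 1 + elen h) r3 m"
    have "reach w P 1 ?c (Config (q' + elen g) r3 m)"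
      using reach_exec [of P ?c "JmpEq d d (q' + elen g)" w] code(5) by simp
    moreover have "reach w P (elen e + elen f + 1 + elen h) (Config p r m) ?c"
      using reach_trans [OF j [unfolded if_not_P [OF False]] r3(1)] by simp
    ultimately have "reach w P (elen (Cond c e f g h)) (Config p r m) (Config (q' + elen g) r3 m)"
      using reach_trans by fastforce
    then show ?thesis
      using r3 False g same2 by (intro exI [of _ r3]) (auto simp: same_def q'_def q_def add_ac)
  qed
qed

text \<open>The common head of the code for \<open>Test\<close> and \<open>While\<close>.\<close>

lemma compare_correct:
  assumes "code_at P p (ecode d p e @ ecode (d + 1) (p + elen e) f @ [jump c d (d + 1) l])"
    "evars e \<subseteq> {..<d}" "evars f \<subseteq> {..<d}" "words w r" "words w m"
  shows "\<exists>r'. reach w P (elen e + elen f + 1) (Config p r m)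
      (Config (if holds c (eval w r m e) (eval w r m f) then l else p + elen e + elen f + 1) r' m) \<and>
    same d r r' \<and> words w r'"
proof -
  have code: "code_at P p (ecode d p e)" "code_at P (p + elen e) (ecode (d + 1) (p + elen e) f)"
    "code_at P (p + elen e + elen f) [jump c d (d + 1) l]"
    using assms(1) by (simp_all add: add.assoc)
  obtain r1 where r1: "reach w P (elen e) (Config p r m) (Config (p + elen e) r1 m)"
    "r1 d = eval w r m e" "same d r r1" "words w r1"
    using ecode_correct [OF code(1)] assms by blast
  obtain r2 where r2: "reach w P (elen f) (Config (p + elen e) r1 m) (Config (p + elen e + elen f) r2 m)"
    "r2 (d + 1) = eval w r1 m f" "same (d + 1) r1 r2" "words w r2"
    using ecode_correct [OF code(2), of w r1 m] assms r1 by (auto simp: lessThan_Suc)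
  have f: "eval w r1 m f = eval w r m f"
    using eval_same [OF r1(3)] assms by simp
  have e: "r2 d = eval w r m e"
    using r1(2) r2(3) by (simp add: same_def)
  have same2: "same d r r2"
    using r1 r2 by (auto simp: same_def)
  have "reach w P 1 (Config (p + elen e + elen f) r2 m)
      (Config (if holds c (eval w r m e) (eval w r m f) then l else p + elen e + elen f + 1) r2 m)"
    using reach_exec [of P "Config (p + elen e + elen f) r2 m" "jump c d (d + 1) l" w]
      code(3) e r2(2) f by (simp add: exec_jump del: jump.simps)
  then show ?thesis
    using reach_trans [OF reach_trans [OF r1(1) r2(1) order_refl]] same2 r2(4) by blast
qed

lemma same_trans: "same d r r' \<Longrightarrow> same d r' r'' \<Longrightarrow> same d r r''"
  by (simp add: same_def)

lemma same_sym: "same d r r' \<Longrightarrow> same d r' r"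
  by (simp add: same_def)

text \<open>Simulation by induction on the big-step derivation. The target registers
  \<open>\<rho>\<close> are arbitrary above \<open>d\<close> because a loop returns to its head with
  different scratch values.\<close>

lemma ccode_correct:
  assumes "runs w a t s s'" "code_at P p (ccode d p a)" "cvars a \<subseteq> {..<d}"
    "same d (fst s) \<rho>" "words w \<rho>" "words w (snd s)"
  shows "\<exists>\<rho>'. reach w P t (Config p \<rho> (snd s)) (Config (p + clen a) \<rho>' (snd s')) \<and>
    same d (fst s') \<rho>' \<and> words w \<rho>' \<and> words w (snd s')"
  using assms
proof (induction arbitrary: p \<rho> rule: runs.induct)
  case (Assign x e r m)
  have eq: "eval w \<rho> m e = eval w r m e"
    using eval_same Assign.prems by (metis Un_subset_iff cvars.simps(1) fst_conv insert_is_Un)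
  obtain r1 where r1: "reach w P (elen e) (Config p \<rho> m) (Config (p + elen e) r1 m)"
    "r1 d = eval w \<rho> m e" "same d \<rho> r1" "words w r1"
    using ecode_correct [of P p d e w \<rho> m] Assign.prems by auto
  have "reach w P 1 (Config (p + elen e) r1 m) (Config (p + elen e + 1) (r1(x := r1 d)) m)"
    using reach_exec [of P "Config (p + elen e) r1 m" "Op Or x d d" w] exec_move [OF r1(4)]
      Assign.prems by (simp del: exec.simps)
  with r1 have "reach w P (elen e + 1) (Config p \<rho> m) (Config (p + clen (Assign x e)) (r1(x := r1 d)) m)"
    using reach_trans by (simp add: add.assoc)
  moreover have "same d (r(x := eval w r m e)) (r1(x := r1 d))"
    using r1 eq Assign.prems by (auto simp: same_def)
  moreover have "words w (r1(x := r1 d))" "words w m"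
    using r1(4) Assign.prems by (simp_all add: words_upd) (simp add: words_def)
  ultimately show ?case
    by (intro exI [of _ "r1(x := r1 d)"]) (simp del: fun_upd_apply)
next
  case (Write e f r m)
  have code: "code_at P p (ecode d p e)" "code_at P (p + elen e) (ecode (d + 1) (p + elen e) f)"
    "code_at P (p + elen e + elen f) [Store d (d + 1)]"
    using Write.prems(1) by (simp_all add: add.assoc)
  have vars: "evars e \<subseteq> {..<d}" "evars f \<subseteq> {..<d}" and \<rho>: "same d \<rho> r" "words w m" "words w \<rho>"
    using Write.prems by (simp_all add: same_sym)
  obtain r1 where r1: "reach w P (elen e) (Config p \<rho> m) (Config (p + elen e) r1 m)"
    "r1 d = eval w \<rho> m e" "same d \<rho> r1" "words w r1"
    using ecode_correct [OF code(1)] vars \<rho> by blast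
  obtain r2 where r2: "reach w P (elen f) (Config (p + elen e) r1 m) (Config (p + elen e + elen f) r2 m)"
    "r2 (d + 1) = eval w r1 m f" "same (d + 1) r1 r2" "words w r2"
    using ecode_correct [OF code(2), of w r1 m] \<rho> vars r1 by (auto simp: lessThan_Suc)
  have eq: "r2 d = eval w r m e" "r2 (d + 1) = eval w r m f"
    using r1 r2 vars eval_same [OF \<rho>(1)] eval_same [OF r1(3), of f]
    by (simp_all add: same_def)
  have "reach w P 1 (Config (p + elen e + elen f) r2 m)
      (Config (p + elen e + elen f + 1) r2 (m(r2 d := r2 (d + 1))))"
    using reach_exec [of P "Config (p + elen e + elen f) r2 m" "Store d (d + 1)" w] code(3) by simp
  with reach_trans [OF reach_trans [OF r1(1) r2(1) order_refl]]
  have "reach w P (elen e + elen f + 1) (Config p \<rho> m)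
      (Config (p + clen (Write e f)) r2 (m(r2 d := r2 (d + 1))))"
    by (simp add: add.assoc)
  moreover have "same d r r2"
    using r1 r2 \<rho> by (auto simp: same_def)
  moreover have "words w (m(r2 d := r2 (d + 1)))"
    using r2(4) \<rho> by (auto simp: words_def)
  ultimately show ?case
    unfolding eq snd_conv fst_conv using r2(4) by blast
next
  case (Seq a t s s' b u s'')
  obtain r1 where r1: "reach w P t (Config p \<rho> (snd s)) (Config (p + clen a) r1 (snd s'))"
    "same d (fst s') r1" "words w r1" "words w (snd s')"
    using Seq.IH(1) [of p \<rho>] Seq.prems by auto
  obtain r2 where "reach w P u (Config (p + clen a) r1 (snd s')) (Config (p + clen a + clen b) r2 (snd s''))"
    "same d (fst s'') r2" "words w r2" "words w (snd s'')"
    using Seq.IH(2) [of "p + clen a" r1] Seq.prems r1 by auto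
  with reach_trans [OF r1(1) this(1) order_refl] show ?case
    by (auto simp: add.assoc)
next
  case (TestT c r m e f a t s b)
  define l where "l = p + elen e + elen f + 1 + clen b + 1"
  have code: "code_at P p (ecode d p e @ ecode (d + 1) (p + elen e) f @ [jump c d (d + 1) l])"
    "code_at P l (ccode d l a)"
    using TestT.prems(1)
    by (auto simp: l_def Let_def add.assoc code_at_Cons [where i = "jump _ _ _ _" and js = "_ @ _"]
        code_at_Cons [where i = "JmpEq _ _ _" and js = "ccode _ _ _"])
  have vars: "evars e \<subseteq> {..<d}" "evars f \<subseteq> {..<d}" "cvars a \<subseteq> {..<d}"
    and \<rho>: "same d \<rho> r" "words w m" "words w \<rho>"
    using TestT.prems by (simp_all add: same_sym)
  have "holds c (eval w \<rho> m e) (eval w \<rho> m f)"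
    using TestT.hyps(1) eval_same [OF \<rho>(1)] vars by simp
  then obtain r1 where r1: "reach w P (elen e + elen f + 1) (Config p \<rho> m) (Config l r1 m)"
    "same d \<rho> r1" "words w r1"
    using compare_correct [OF code(1) vars(1,2) \<rho>(3,2)] by auto
  obtain r2 where r2: "reach w P t (Config l r1 m) (Config (l + clen a) r2 (snd s))"
    "same d (fst s) r2" "words w r2" "words w (snd s)"
    using TestT.IH [OF code(2) vars(3), of r1] r1 \<rho> same_trans [OF same_sym [OF \<rho>(1)] r1(2)] by auto
  have "reach w P (elen e + elen f + t + 2) (Config p \<rho> m) (Config (l + clen a) r2 (snd s))"
    using reach_trans [OF r1(1) r2(1)] by simp
  then show ?case
    using r2 by (intro exI [of _ r2]) (simp add: l_def add_ac)
next
  case (TestF c r m e f b t s a)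
  define l where "l = p + elen e + elen f + 1 + clen b + 1"
  define q where "q = p + elen e + elen f + 1"
  have code: "code_at P p (ecode d p e @ ecode (d + 1) (p + elen e) f @ [jump c d (d + 1) l])"
    "code_at P q (ccode d q b)" "code_at P (q + clen b) [JmpEq d d (l + clen a)]"
    using TestF.prems(1)
    by (auto simp: l_def q_def Let_def add.assoc code_at_Cons [where i = "jump _ _ _ _" and js = "_ @ _"]
        code_at_Cons [where i = "JmpEq _ _ _" and js = "ccode _ _ _"])
  have vars: "evars e \<subseteq> {..<d}" "evars f \<subseteq> {..<d}" "cvars b \<subseteq> {..<d}"
    and \<rho>: "same d \<rho> r" "words w m" "words w \<rho>"
    using TestF.prems by (simp_all add: same_sym)
  have "\<not> holds c (eval w \<rho> m e) (eval w \<rho> m f)"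
    using TestF.hyps(1) eval_same [OF \<rho>(1)] vars by simp
  then obtain r1 where r1: "reach w P (elen e + elen f + 1) (Config p \<rho> m) (Config q r1 m)"
    "same d \<rho> r1" "words w r1"
    using compare_correct [OF code(1) vars(1,2) \<rho>(3,2)] by (auto simp: q_def)
  obtain r2 where r2: "reach w P t (Config q r1 m) (Config (q + clen b) r2 (snd s))"
    "same d (fst s) r2" "words w r2" "words w (snd s)"
    using TestF.IH [OF code(2) vars(3), of r1] r1 \<rho> same_trans [OF same_sym [OF \<rho>(1)] r1(2)] by auto
  have "reach w P 1 (Config (q + clen b) r2 (snd s)) (Config (l + clen a) r2 (snd s))"
    using reach_exec [of P "Config (q + clen b) r2 (snd s)" "JmpEq d d (l + clen a)" w] code(3) by simp
  then have "reach w P (elen e + elen f + t + 2) (Config p \<rho> m) (Config (l + clen a) r2 (snd s))"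
    using reach_trans [OF reach_trans [OF r1(1) r2(1) order_refl]] by simp
  then show ?case
    using r2 by (intro exI [of _ r2]) (simp add: l_def add_ac)
next
  case (WhileF c r m e f a)
  define q where "q = p + elen e + elen f + 1"
  have code: "code_at P p (ecode d p e @ ecode (d + 1) (p + elen e) f @ [jump c d (d + 1) (q + 1)])"
    "code_at P q [JmpEq d d (p + clen (While c e f a))]"
    using WhileF.prems(1)
    by (auto simp: eval_nat_numeral q_def Let_def add_ac code_at_Cons [where i = "jump _ _ _ _" and js = "_ # _"]
        code_at_Cons [where i = "JmpEq _ _ _" and js = "_ @ _"])
  have vars: "evars e \<subseteq> {..<d}" "evars f \<subseteq> {..<d}"
    and \<rho>: "same d \<rho> r" "words w m" "words w \<rho>"
    using WhileF.prems by (simp_all add: same_sym)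
  have "\<not> holds c (eval w \<rho> m e) (eval w \<rho> m f)"
    using WhileF.hyps(1) eval_same [OF \<rho>(1)] vars by simp
  then obtain r1 where r1: "reach w P (elen e + elen f + 1) (Config p \<rho> m) (Config q r1 m)"
    "same d \<rho> r1" "words w r1"
    using compare_correct [OF code(1) vars(1,2) \<rho>(3,2)] by (auto simp: q_def)
  have "reach w P 1 (Config q r1 m) (Config (p + clen (While c e f a)) r1 m)"
    using reach_exec [of P "Config q r1 m" "JmpEq d d (p + clen (While c e f a))" w] code(2) by simp
  then have "reach w P (elen e + elen f + 3) (Config p \<rho> m) (Config (p + clen (While c e f a)) r1 m)"
    using reach_trans [OF r1(1)] by simp
  then show ?case
    using r1 \<rho> same_trans [OF same_sym [OF \<rho>(1)] r1(2)] by auto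
next
  case (WhileT c r m e f a t s u s')
  define q where "q = p + elen e + elen f + 2"
  have code: "code_at P p (ecode d p e @ ecode (d + 1) (p + elen e) f @ [jump c d (d + 1) q])"
    "code_at P q (ccode d q a)" "code_at P (q + clen a) [JmpEq d d p]"
    using WhileT.prems(1)
    by (auto simp: q_def Let_def add_ac code_at_Cons [where i = "jump _ _ _ _" and js = "_ # _"]
        code_at_Cons [where i = "JmpEq _ _ _" and js = "_ @ _"])
  have vars: "evars e \<subseteq> {..<d}" "evars f \<subseteq> {..<d}" "cvars a \<subseteq> {..<d}"
    and \<rho>: "same d \<rho> r" "words w m" "words w \<rho>"
    using WhileT.prems by (simp_all add: same_sym)
  have "holds c (eval w \<rho> m e) (eval w \<rho> m f)"
    using WhileT.hyps(1) eval_same [OF \<rho>(1)] vars by simp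
  then obtain r1 where r1: "reach w P (elen e + elen f + 1) (Config p \<rho> m) (Config q r1 m)"
    "same d \<rho> r1" "words w r1"
    using compare_correct [OF code(1) vars(1,2) \<rho>(3,2)] by auto
  obtain r2 where r2: "reach w P t (Config q r1 m) (Config (q + clen a) r2 (snd s))"
    "same d (fst s) r2" "words w r2" "words w (snd s)"
    using WhileT.IH(1) [OF code(2) vars(3), of r1] r1 \<rho> same_trans [OF same_sym [OF \<rho>(1)] r1(2)] by auto
  have "reach w P 1 (Config (q + clen a) r2 (snd s)) (Config p r2 (snd s))"
    using reach_exec [of P "Config (q + clen a) r2 (snd s)" "JmpEq d d p" w] code(3) by simp
  then have again: "reach w P (elen e + elen f + 3 + t) (Config p \<rho> m) (Config p r2 (snd s))"
    using reach_trans [OF reach_trans [OF r1(1) r2(1) order_refl]] by simp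
  obtain r3 where "reach w P u (Config p r2 (snd s)) (Config (p + clen (While c e f a)) r3 (snd s'))"
    "same d (fst s') r3" "words w r3" "words w (snd s')"
    using WhileT.IH(2) [OF WhileT.prems(1,2) r2(2-4)] by auto
  with reach_trans [OF again this(1)] show ?case
    by auto
qed

lemma runs_halts:
  assumes "runs w a t (r, m) s" "cvars a \<subseteq> {..<d}" "words w r" "words w m"
  shows "\<exists>k\<le>t. halted (ccode d 0 a) ((step w (ccode d 0 a) ^^ k) (Config 0 r m)) \<and>
    mem ((step w (ccode d 0 a) ^^ k) (Config 0 r m)) = snd s"
proof -
  have "code_at (ccode d 0 a) 0 (ccode d 0 a)"
    unfolding code_at_def by auto
  from ccode_correct [OF assms(1) this assms(2), of r] assms
  obtain k r' where "k \<le> t" "(step w (ccode d 0 a) ^^ k) (Config 0 r m) = Config (clen a) r' (snd s)"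
    unfolding reach_def by auto
  then show ?thesis
    by (intro exI [of _ k]) (simp add: halted_def)
qed

section \<open>Total correctness and interpretation of a program\<close>

definition wp :: "nat \<Rightarrow> com \<Rightarrow> nat \<Rightarrow> ((nat \<Rightarrow> nat) \<times> (nat \<Rightarrow> nat) \<Rightarrow> bool) \<Rightarrow>
    (nat \<Rightarrow> nat) \<times> (nat \<Rightarrow> nat) \<Rightarrow> bool" where
  "wp w a t Q s \<longleftrightarrow> (\<exists>k s'. k \<le> t \<and> runs w a k s s' \<and> Q s')"

lemma wp_mono: "wp w a t Q s \<Longrightarrow> (\<And>r m. Q (r, m) \<Longrightarrow> Q' (r, m)) \<Longrightarrow> t \<le> t' \<Longrightarrow> wp w a t' Q' s"
  unfolding wp_def by (metis le_trans surj_pair)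

lemma wp_Seq:
  assumes "wp w a t (wp w b u Q) s"
  shows "wp w (Seq a b) (t + u) Q s"
proof -
  obtain k s' where "k \<le> t" "runs w a k s s'" "wp w b u Q s'"
    using assms unfolding wp_def by blast
  moreover then obtain l s'' where "l \<le> u" "runs w b l s' s''" "Q s''"
    unfolding wp_def by blast
  ultimately show ?thesis
    unfolding wp_def by (meson add_mono runs.Seq)
qed

text \<open>All loops of the reduction have a number \<open>K\<close> of iterations that is known
  beforehand, so an invariant indexed by the iteration replaces a variant and gives the time bound
  directly.\<close>

lemma wp_While:
  assumes "Inv 0 s"
    and "\<And>i r m. i < K \<Longrightarrow> Inv i (r, m) \<Longrightarrow>
      holds c (eval w r m e) (eval w r m f) \<and> wp w a t (Inv (Suc i)) (r, m)"
    and "\<And>r m. Inv K (r, m) \<Longrightarrow> \<not> holds c (eval w r m e) (eval w r m f) \<and> Q (r, m)"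
  shows "wp w (While c e f a) (K * (t + (elen e + elen f + 3)) + (elen e + elen f + 3)) Q s"
proof -
  let ?h = "elen e + elen f + 3"
  \<comment> \<open>Here \<open>j\<close> counts the iterations that remain, so the invariant has
    index \<open>K - j\<close>.\<close>
  have "wp w (While c e f a) (j * (t + ?h) + ?h) Q s" if "Inv (K - j) s" "j \<le> K" for j s
    using that
  proof (induction j arbitrary: s)
    case 0
    then show ?case
      using assms(3) [of "fst s" "snd s"] runs.WhileF [of c w "fst s" "snd s" e f a]
      unfolding wp_def by (intro exI [of _ ?h] exI [of _ s]) auto
  next
    case (Suc j)
    obtain k s' where s': "k \<le> t" "runs w a k s s'" "Inv (Suc (K - Suc j)) s'"
      and c: "holds c (eval w (fst s) (snd s) e) (eval w (fst s) (snd s) f)"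
      using assms(2) [of "K - Suc j" "fst s" "snd s"] Suc.prems by (auto simp: wp_def)
    moreover have "Suc (K - Suc j) = K - j"
      using Suc.prems by simp
    ultimately obtain l s'' where "l \<le> j * (t + ?h) + ?h" "runs w (While c e f a) l s' s''" "Q s''"
      using Suc.IH [of s'] Suc.prems by (auto simp: wp_def)
    moreover have "runs w (While c e f a) (?h + k + l) s s''"
      using runs.WhileT [OF c, of a k s' l s''] s' calculation by simp
    ultimately show ?case
      using s'(1) unfolding wp_def by (intro exI [of _ "?h + k + l"] exI [of _ s'']) auto
  qed
  from this [of K] show ?thesis
    using assms(1) by simp
qed

text \<open>Code without loops executes each instruction at most once. Its effect can be computed by
  rewriting with \<open>sem\<close>, and \<open>clen\<close> bounds its time.\<close>

fun loop_free :: "com \<Rightarrow> bool" where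
  "loop_free (Assign x e) = True"
| "loop_free (Write e f) = True"
| "loop_free (Seq a b) = (loop_free a \<and> loop_free b)"
| "loop_free (Test c e f a b) = (loop_free a \<and> loop_free b)"
| "loop_free (While c e f a) = False"

text \<open>Only meaningful for commands without loops; the last equation is arbitrary.\<close>

fun sem :: "nat \<Rightarrow> com \<Rightarrow> (nat \<Rightarrow> nat) \<times> (nat \<Rightarrow> nat) \<Rightarrow> (nat \<Rightarrow> nat) \<times> (nat \<Rightarrow> nat)" where
  "sem w (Assign x e) (r, m) = (r(x := eval w r m e), m)"
| "sem w (Write e f) (r, m) = (r, m(eval w r m e := eval w r m f))"
| "sem w (Seq a b) s = sem w b (sem w a s)"
| "sem w (Test c e f a b) (r, m) =
     (if holds c (eval w r m e) (eval w r m f) then sem w a (r, m) else sem w b (r, m))"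
| "sem w (While c e f a) s = s"

lemma runs_sem: "loop_free a \<Longrightarrow> \<exists>k\<le>clen a. runs w a k s (sem w a s)"
proof (induction a arbitrary: s)
  case (Assign x e)
  then show ?case
    using runs.Assign [of w x e "fst s" "snd s"] by (cases s) auto
next
  case (Write e f)
  then show ?case
    using runs.Write [of w e f "fst s" "snd s"] by (cases s) auto
next
  case (Seq a b)
  obtain k l where "k \<le> clen a" "runs w a k s (sem w a s)" "l \<le> clen b"
    "runs w b l (sem w a s) (sem w b (sem w a s))"
    using Seq.IH(1) [of s] Seq.IH(2) [of "sem w a s"] Seq.prems by auto
  then show ?case
    by (intro exI [of _ "k + l"]) (auto intro: runs.Seq)
next
  case (Test c e f a b)
  obtain r m where s: "s = (r, m)"
    by (cases s)
  obtain k l where "k \<le> clen a" "runs w a k s (sem w a s)" "l \<le> clen b" "runs w b l s (sem w b s)"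
    using Test.IH(1) [of s] Test.IH(2) [of s] Test.prems by auto
  then show ?case
    using runs.TestT [of c w r m e f a k "sem w a s" b] runs.TestF [of c w r m e f b l "sem w b s" a]
    by (cases "holds c (eval w r m e) (eval w r m f)")
      (force simp: s intro!: exI [of _ "elen e + elen f + k + 2"],
       force simp: s intro!: exI [of _ "elen e + elen f + l + 2"])
qed simp

lemma wp_sem: "loop_free a \<Longrightarrow> Q (sem w a s) \<Longrightarrow> clen a \<le> t \<Longrightarrow> wp w a t Q s"
  unfolding wp_def using runs_sem [of a w s] by (meson le_trans)

lemma wp_sem_Seq:
  "loop_free a \<Longrightarrow> wp w b u Q (sem w a s) \<Longrightarrow> wp w (Seq a b) (clen a + u) Q s"
  by (rule wp_Seq [OF wp_sem]) auto

lemma nat_mod_int: "nat (int x mod 2 ^ w) = x mod 2 ^ w"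
  by (simp add: nat_mod_distrib nat_power_eq)

lemma eval_arith:
  "eval w r m (Bin Add e f) = (eval w r m e + eval w r m f) mod 2 ^ w"
  "eval w r m (Bin Mul e f) = (eval w r m e * eval w r m f) mod 2 ^ w"
  "eval w r m (Bin Div e f) = (eval w r m e div eval w r m f) mod 2 ^ w"
  "eval w r m (Bin Mod e f) = (eval w r m e mod eval w r m f) mod 2 ^ w"
  by (simp_all flip: of_nat_add of_nat_mult add: nat_mod_int)


section \<open>Interpreting a program with a shorter word length\<close>

fun instr_regs :: "instr \<Rightarrow> nat set" where
  "instr_regs (Const d k) = {d}"
| "instr_regs (Op b d s t) = {d, s, t}"
| "instr_regs (Load d s) = {d, s}"
| "instr_regs (Store d s) = {d, s}"
| "instr_regs (JmpEq s t l) = {s, t}"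
| "instr_regs (JmpLess s t l) = {s, t}"

text \<open>
  A program is interpreted with its registers moved up by 20 and its memory by the content of
  register 5. Register 8 is its program counter, and register 4 contains \<open>2 ^ v\<close> for its word
  length \<open>v\<close>, which is smaller than the word length of the interpreter.
\<close>

fun interpret_instr :: "nat \<Rightarrow> nat \<Rightarrow> instr \<Rightarrow> com" where
  "interpret_instr l i (Const d k) =
     Seq (Assign (20 + d) (Bin Mod (Num k) (Reg 4))) (Assign 8 (Num (i + 1)))"
| "interpret_instr l i (Op b d s t) =
     Seq (Assign (20 + d) (Bin Mod (Bin b (Reg (20 + s)) (Reg (20 + t))) (Reg 4)))
       (Assign 8 (Num (i + 1)))"
| "interpret_instr l i (Load d s) =
     Seq (Assign (20 + d) (Mem (Bin Add (Reg 5) (Reg (20 + s))))) (Assign 8 (Num (i + 1)))"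
| "interpret_instr l i (Store d s) =
     Seq (Write (Bin Add (Reg 5) (Reg (20 + d))) (Reg (20 + s))) (Assign 8 (Num (i + 1)))"
| "interpret_instr l i (JmpEq s t j) =
     Assign 8 (Cond Equal (Reg (20 + s)) (Reg (20 + t)) (Num (min j l)) (Num (i + 1)))"
| "interpret_instr l i (JmpLess s t j) =
     Assign 8 (Cond Less (Reg (20 + s)) (Reg (20 + t)) (Num (min j l)) (Num (i + 1)))"

text \<open>Jump targets are constants, so the current instruction is selected by a chain of
  comparisons of constant length. After the earlier tests have failed, being less than
  \<open>i + 1\<close> means being equal to \<open>i\<close>.\<close>

fun dispatch :: "nat \<Rightarrow> nat \<Rightarrow> program \<Rightarrow> com" where
  "dispatch l i [] = Assign 8 (Reg 8)"
| "dispatch l i (a # P) =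
     Test Less (Reg 8) (Num (i + 1)) (interpret_instr l i a) (dispatch l (i + 1) P)"

lemma loop_free_interpret [simp]: "loop_free (interpret_instr l i a)"
  by (cases a) auto

lemma loop_free_dispatch [simp]: "loop_free (dispatch l i P)"
  by (induction P arbitrary: i) auto

lemma sem_dispatch:
  assumes "i \<le> r 8" "r 8 < i + length P" "i + length P < 2 ^ w"
  shows "sem w (dispatch l i P) (r, m) = sem w (interpret_instr l (r 8) (P ! (r 8 - i))) (r, m)"
  using assms
proof (induction P arbitrary: i)
  case (Cons a P)
  show ?case
  proof (cases "r 8 = i")
    case True
    then show ?thesis
      using Cons.prems by simp
  next
    case False
    then have "r 8 - i = Suc (r 8 - Suc i)"
      using Cons.prems by simp
    then show ?thesis
      using Cons.IH [of "Suc i"] Cons.prems False by simp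
  qed
qed simp

text \<open>
  The invariant of the interpreter, which started with registers \<open>r0\<close> and memory \<open>m0\<close>.
\<close>

definition interprets :: "nat \<Rightarrow> program \<Rightarrow> nat \<Rightarrow> (nat \<Rightarrow> nat) \<Rightarrow> (nat \<Rightarrow> nat) \<Rightarrow>
    config \<Rightarrow> (nat \<Rightarrow> nat) \<times> (nat \<Rightarrow> nat) \<Rightarrow> bool" where
  "interprets v P R r0 m0 c s \<longleftrightarrow>
     fst s 8 = min (pc c) (length P) \<and>
     (\<forall>x<R. fst s (20 + x) = regs c x) \<and>
     (\<forall>x<20. x \<noteq> 8 \<longrightarrow> fst s x = r0 x) \<and>
     (\<forall>y<2 ^ v. snd s (r0 5 + y) = mem c y) \<and>
     (\<forall>y. y < r0 5 \<or> r0 5 + 2 ^ v \<le> y \<longrightarrow> snd s y = m0 y) \<and>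
     words v (regs c) \<and> words v (mem c)"

lemma words_exec:
  "words v (regs c) \<Longrightarrow> words v (mem c) \<Longrightarrow>
    words v (regs (exec v a c)) \<and> words v (mem (exec v a c))"
  by (cases c; cases a) (auto simp: words_def nat_mod_less)

text \<open>Since \<open>2 ^ v\<close> divides \<open>2 ^ w\<close>, a result computed in long words
  and then reduced modulo \<open>2 ^ v\<close> is the result that short words would have given,
  negative differences included.\<close>

lemma nat_mod_mod:
  assumes "v \<le> w"
  shows "nat (k mod 2 ^ w) mod 2 ^ v = nat (k mod 2 ^ v)"
proof -
  have "nat (k mod 2 ^ w) mod 2 ^ v = nat (k mod 2 ^ w mod 2 ^ v)"
    by (simp add: nat_mod_distrib nat_power_eq)
  also have "k mod 2 ^ w mod 2 ^ v = k mod 2 ^ v"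
    using assms by (simp add: mod_mod_cancel le_imp_power_dvd)
  finally show ?thesis .
qed

text \<open>Interpreted addresses are below \<open>2 ^ v\<close>, so adding the base in register 5
  does not wrap. Jump targets are capped at \<open>length P\<close>: a larger target might not fit
  into a word, and all targets from there on mean halting.\<close>

lemma interprets_step:
  assumes s: "interprets v P R r0 m0 c s" and "\<not> halted P c"
    and r0: "r0 4 = 2 ^ v" "r0 5 + 2 ^ v \<le> 2 ^ w"
    and P: "length P < 2 ^ w" "\<And>a. a \<in> set P \<Longrightarrow> instr_regs a \<subseteq> {..<R}"
  shows "interprets v P R r0 m0 (step v P c) (sem w (dispatch (length P) 0 P) s)"
proof -
  obtain p \<rho> \<mu> where c: "c = Config p \<rho> \<mu>"
    by (cases c)
  obtain r m where rm: "s = (r, m)"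
    by (cases s)
  have p: "p < length P" "r 8 = p"
    using s assms(2) by (auto simp: c rm halted_def interprets_def)
  have "v \<le> w"
    using r0(2) by (meson add_leD2 one_less_numeral_iff power_le_imp_le_exp semiring_norm(76))
  note mods = nat_mod_mod [OF this] nat_mod_mod [OF this, of "int _", unfolded nat_mod_int]
  have sem: "sem w (dispatch (length P) 0 P) s = sem w (interpret_instr (length P) p (P ! p)) (r, m)"
    using sem_dispatch [of 0 r P w "length P" m] p P(1) by (simp add: rm)
  have R: "instr_regs (P ! p) \<subseteq> {..<R}"
    using P(2) p(1) by simp
  have step: "step v P c = exec v (P ! p) c"
    using assms(2) by (simp add: step_def c)
  have reg: "r (20 + x) = \<rho> x" if "x < R" for x
    using s that by (simp add: c rm interprets_def)
  have low: "r x = r0 x" if "x < 20" "x \<noteq> 8" for x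
    using s that by (simp add: c rm interprets_def)
  have mem: "m (r0 5 + y) = \<mu> y" if "y < 2 ^ v" for y
    using s that by (simp add: c rm interprets_def)
  have words: "\<rho> x < 2 ^ v" for x
    using s by (simp add: c rm interprets_def words_def)
  have not_words: "\<not> 2 ^ v \<le> \<rho> x" for x
    using words [of x] by simp
  have add: "nat (binop_val Add (r0 5) (\<rho> x) mod 2 ^ w) = r0 5 + \<rho> x" for x
    using words [of x] r0(2) by (simp flip: of_nat_add add: nat_mod_int)
  have modulo: "nat (binop_val Mod x (2 ^ v) mod 2 ^ w) = x mod 2 ^ v" for x
  proof -
    have "x mod 2 ^ v < 2 ^ w"
      using \<open>v \<le> w\<close> by (meson less_le_trans mod_less_divisor power_increasing one_le_numeral zero_less_power zero_less_numeral)
    then show ?thesis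
      using nat_mod_int [of "x mod 2 ^ v" w] by (simp add: zmod_int)
  qed
  have "words v (regs (exec v (P ! p) c)) \<and> words v (mem (exec v (P ! p) c))"
    using s by (intro words_exec) (simp_all add: interprets_def)
  moreover have "p + 1 < 2 ^ w"
    using p P(1) by simp
  moreover have "min k (length P) < 2 ^ w" for k
    using P(1) by simp
  \<comment> \<open>As \<open>binop_val\<close> stays folded, one argument covers all ten
    operators.\<close>
  ultimately show ?thesis
    using s R p P(1) unfolding sem step unfolding c rm
    by (cases "P ! p")
      (auto simp: interprets_def reg low mem r0 mods add modulo words not_words simp del: binop_val.simps)
qed


text \<open>The size parameter of the interpreted program is kept in register 1. Its registers,
  unlike its memory, are few enough to be cleared before each call.\<close>

fun load_regs :: "nat \<Rightarrow> com" where
  "load_regs 0 = Assign 8 (Num 0)"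
| "load_regs (Suc R) = Seq (load_regs R) (Assign (20 + R) (if R = 0 then Reg 1 else Num 0))"

lemma loop_free_load_regs [simp]: "loop_free (load_regs R)"
  by (induction R) auto

lemma sem_load_regs:
  "\<exists>r'. sem w (load_regs R) (r, m) = (r', m) \<and> r' 8 = 0 \<and>
    (\<forall>x<20. x \<noteq> 8 \<longrightarrow> r' x = r x) \<and> (\<forall>x<R. r' (20 + x) = (if x = 0 then r 1 else 0))"
proof (induction R)
  case (Suc R)
  then obtain r' where "sem w (load_regs R) (r, m) = (r', m)" "r' 8 = 0"
    "\<forall>x<20. x \<noteq> 8 \<longrightarrow> r' x = r x" "\<forall>x<R. r' (20 + x) = (if x = 0 then r 1 else 0)"
    by blast
  then show ?case
    by (auto simp: less_Suc_eq)
qed auto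

definition call :: "program \<Rightarrow> nat \<Rightarrow> com" where
  "call P R = Seq (load_regs R)
     (While Less (Reg 8) (Num (length P)) (dispatch (length P) 0 P))"

text \<open>The summand 5 is the cost of one test of the loop in \<open>call\<close>.\<close>

definition call_cost :: "program \<Rightarrow> nat \<Rightarrow> nat" where
  "call_cost P R = clen (load_regs R) + clen (dispatch (length P) 0 P) + 5"

lemma halted_funpow: "halted P c \<Longrightarrow> (step v P ^^ k) c = c"
  by (induction k) (simp_all add: step_def)

text \<open>\<open>run_within\<close> provides some time at which the program has halted, but the
  interpreter stops at the first such time. A halted configuration no longer changes, so both
  agree.\<close>

lemma first_halted:
  assumes "halted P ((step v P ^^ k) c)"
  shows "\<exists>j\<le>k. (step v P ^^ j) c = (step v P ^^ k) c \<and> (\<forall>i<j. \<not> halted P ((step v P ^^ i) c))"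
proof -
  define j where "j = (LEAST j. halted P ((step v P ^^ j) c))"
  have j: "halted P ((step v P ^^ j) c)" "j \<le> k"
    unfolding j_def using assms by (auto intro: LeastI Least_le)
  have "(step v P ^^ k) c = (step v P ^^ (k - j)) ((step v P ^^ j) c)"
    using j(2) by (metis comp_apply funpow_add le_add_diff_inverse2)
  also have "\<dots> = (step v P ^^ j) c"
    using halted_funpow [OF j(1)] .
  finally show ?thesis
    using j(2) not_less_Least unfolding j_def by metis
qed

lemma wp_call:
  assumes r: "r 4 = 2 ^ v" "r 5 + 2 ^ v \<le> 2 ^ w"
    and P: "length P < 2 ^ w" "\<And>a. a \<in> set P \<Longrightarrow> instr_regs a \<subseteq> {..<R}"
    and input: "input_fits v (r 1) xs"
    and m: "\<And>y. y < 2 ^ v \<Longrightarrow> m (r 5 + y) = (if y < length xs then xs ! y else 0)"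
    and k: "halted P ((step v P ^^ k) (init (r 1) xs))"
  shows "wp w (call P R) ((k + 1) * call_cost P R)
    (\<lambda>(r', m'). (\<forall>x<20. x \<noteq> 8 \<longrightarrow> r' x = r x) \<and>
      (\<forall>y. y < r 5 \<or> r 5 + 2 ^ v \<le> y \<longrightarrow> m' y = m y) \<and>
      (\<forall>y<2 ^ v. m' (r 5 + y) = mem ((step v P ^^ k) (init (r 1) xs)) y)) (r, m)"
    (is "wp w _ _ ?Q _")
proof -
  obtain r' where r': "sem w (load_regs R) (r, m) = (r', m)" "r' 8 = 0"
    "\<forall>x<20. x \<noteq> 8 \<longrightarrow> r' x = r x" "\<forall>x<R. r' (20 + x) = (if x = 0 then r 1 else 0)"
    using sem_load_regs by blast
  obtain j where j: "j \<le> k" "(step v P ^^ j) (init (r 1) xs) = (step v P ^^ k) (init (r 1) xs)"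
    and before: "\<And>i. i < j \<Longrightarrow> \<not> halted P ((step v P ^^ i) (init (r 1) xs))"
    using first_halted [OF k] by blast
  let ?loop = "While Less (Reg 8) (Num (length P)) (dispatch (length P) 0 P)"
  let ?t = "clen (dispatch (length P) 0 P)"
  let ?h = "elen (Reg 8) + elen (Num (length P)) + 3"
  define Inv where "Inv i = interprets v P R r' m ((step v P ^^ i) (init (r 1) xs))" for i
  have r'45: "r' 4 = 2 ^ v" "r' 5 + 2 ^ v \<le> 2 ^ w" "r' 5 = r 5"
    using r r'(3) by simp_all
  have "wp w ?loop (j * (?t + ?h) + ?h) ?Q (r', m)"
  proof (rule wp_While [where Inv = Inv])
    show "Inv 0 (r', m)"
      using r' input m by (auto simp: Inv_def interprets_def init_def input_fits_def words_def)
  next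
    fix i \<rho> \<mu>
    assume "i < j" "Inv i (\<rho>, \<mu>)"
    then show "holds Less (eval w \<rho> \<mu> (Reg 8)) (eval w \<rho> \<mu> (Num (length P))) \<and>
        wp w (dispatch (length P) 0 P) ?t (Inv (Suc i)) (\<rho>, \<mu>)"
      using before [OF \<open>i < j\<close>] interprets_step [OF _ _ r'45(1,2) P,
          where c = "(step v P ^^ i) (init (r 1) xs)" and s = "(\<rho>, \<mu>)" and ?m0.0 = m] P(1)
      by (auto simp: Inv_def halted_def interprets_def [of v P R r' m _ "(\<rho>, \<mu>)"] intro!: wp_sem)
  next
    fix \<rho> \<mu>
    assume "Inv j (\<rho>, \<mu>)"
    then show "\<not> holds Less (eval w \<rho> \<mu> (Reg 8)) (eval w \<rho> \<mu> (Num (length P))) \<and> ?Q (\<rho>, \<mu>)"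
      using k P(1) r'(3) r'45(3) unfolding Inv_def j(2)
      by (auto simp: interprets_def halted_def)
  qed
  then have run: "wp w (call P R) (clen (load_regs R) + (j * (?t + ?h) + ?h)) ?Q (r, m)"
    unfolding call_def by (intro wp_sem_Seq) (simp_all add: r'(1))
  have "clen (load_regs R) + (j * (?t + ?h) + ?h) \<le> (k + 1) * call_cost P R"
  proof -
    have "j * (?t + ?h) \<le> k * call_cost P R"
      using j(1) by (intro mult_mono) (auto simp: call_cost_def)
    then show ?thesis
      by (simp add: call_cost_def)
  qed
  then show ?thesis
    by (rule wp_mono [OF run, rotated])
qed

section \<open>Filling matrices in memory\<close>

text \<open>In the new entries \<open>e\<close>, registers 9 and 10 stand for the row and the column.\<close>

definition fill :: "nat \<Rightarrow> exp \<Rightarrow> exp \<Rightarrow> com" where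
  "fill d b e = Seq (Assign 6 (Num 0)) (While Less (Reg 6) (Bin Mul (Reg d) (Reg d))
     (Seq (Assign 9 (Bin Div (Reg 6) (Reg d))) (Seq (Assign 10 (Bin Mod (Reg 6) (Reg d)))
       (Seq (Write (Bin Add b (Reg 6)) e) (Assign 6 (Bin Add (Reg 6) (Num 1)))))))"

definition off_loop :: "(nat \<Rightarrow> nat) \<Rightarrow> (nat \<Rightarrow> nat) \<Rightarrow> bool" where
  "off_loop r r' \<longleftrightarrow> (\<forall>x. x \<notin> {6, 9, 10} \<longrightarrow> r' x = r x)"

definition filled :: "nat \<Rightarrow> nat \<Rightarrow> (nat \<Rightarrow> nat \<Rightarrow> nat) \<Rightarrow> (nat \<Rightarrow> nat) \<Rightarrow> nat \<Rightarrow> nat" where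
  "filled b n f m y = (if b \<le> y \<and> y < b + n * n then f ((y - b) div n) ((y - b) mod n) else m y)"

text \<open>When an entry is computed, the entries before it are already overwritten, so
  \<open>e\<close> may rely on the old memory only outside of them. The old value of the entry
  itself is still there, which permits updates in place.\<close>

lemma wp_fill:
  assumes d: "r d = n" "d \<notin> {6, 9, 10}" and fits: "n * n < 2 ^ w" "a + n * n \<le> 2 ^ w"
    and b: "\<And>r' m'. off_loop r r' \<Longrightarrow> eval w r' m' b = a"
    and e: "\<And>r' m'. off_loop r r' \<Longrightarrow> r' 9 < n \<Longrightarrow> r' 10 < n \<Longrightarrow>
      (\<And>y. y < a \<or> a + r' 9 * n + r' 10 \<le> y \<Longrightarrow> m' y = m y) \<Longrightarrow>
      eval w r' m' e = f (r' 9) (r' 10)"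
  shows "wp w (fill d b e) ((n * n + 1) * (elen b + elen e + 22))
    (\<lambda>(r', m'). off_loop r r' \<and> m' = filled a n f m) (r, m)"
proof -
  let ?body = "Seq (Assign 9 (Bin Div (Reg 6) (Reg d))) (Seq (Assign 10 (Bin Mod (Reg 6) (Reg d)))
       (Seq (Write (Bin Add b (Reg 6)) e) (Assign 6 (Bin Add (Reg 6) (Num 1)))))"
  define part where
    "part i y = (if a \<le> y \<and> y < a + i then f ((y - a) div n) ((y - a) mod n) else m y)" for i y
  define Inv where "Inv i s \<longleftrightarrow> off_loop r (fst s) \<and> fst s 6 = i \<and> snd s = part i" for i s
  have "wp w (While Less (Reg 6) (Bin Mul (Reg d) (Reg d)) ?body)
      (n * n * (clen ?body + (elen (Reg 6) + elen (Bin Mul (Reg d) (Reg d)) + 3)) +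
        (elen (Reg 6) + elen (Bin Mul (Reg d) (Reg d)) + 3))
      (\<lambda>(r', m'). off_loop r r' \<and> m' = filled a n f m) (r(6 := 0), m)"
  proof (rule wp_While [where Inv = Inv])
    show "Inv 0 (r(6 := 0), m)"
      by (auto simp: Inv_def off_loop_def part_def)
  next
    fix i \<rho> \<mu>
    assume i: "i < n * n" and "Inv i (\<rho>, \<mu>)"
    then have \<rho>: "off_loop r \<rho>" "\<rho> 6 = i" "\<mu> = part i" "\<rho> d = n"
      using d by (auto simp: Inv_def off_loop_def)
    have n: "0 < n"
      using i by (cases n) auto
    have quot: "i div n < n" "i mod n < n"
      using i n by (simp_all add: less_mult_imp_div_less)
    have small: "i div n < 2 ^ w" "i mod n < 2 ^ w" "i + 1 < 2 ^ w" "a + i < 2 ^ w"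
      using i fits quot by (auto simp: le_less_trans [OF div_le_dividend] le_less_trans [OF mod_less_eq_dividend])
    define \<rho>' where "\<rho>' = \<rho>(9 := i div n, 10 := i mod n)"
    have \<rho>': "off_loop r \<rho>'"
      using \<rho>(1) by (auto simp: \<rho>'_def off_loop_def)
    have off: "\<mu> y = m y" if "y < a \<or> a + \<rho>' 9 * n + \<rho>' 10 \<le> y" for y
      using that by (auto simp: \<rho>'_def \<rho>(3) part_def)
    have e': "eval w \<rho>' \<mu> e = f (i div n) (i mod n)"
      using e [OF \<rho>' _ _ off] quot by (simp add: \<rho>'_def)
    have "w \<noteq> 0"
      using small(3) by (intro notI) simp
    have d9: "d \<noteq> 9" "d \<noteq> 10" "d \<noteq> 6"
      using d by auto
    have "sem w ?body (\<rho>, \<mu>) = (\<rho>'(6 := i + 1), \<mu>(a + i := f (i div n) (i mod n)))"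
      using small \<rho> d9 \<open>w \<noteq> 0\<close> b [OF \<rho>'] e' unfolding \<rho>'_def
      by (simp add: eval_arith del: eval.simps(3) binop_val.simps)
    moreover have "Inv (Suc i) (\<rho>'(6 := i + 1), \<mu>(a + i := f (i div n) (i mod n)))"
      using \<rho>' by (auto simp: Inv_def off_loop_def \<rho>(3) part_def)
    ultimately show "holds Less (eval w \<rho> \<mu> (Reg 6)) (eval w \<rho> \<mu> (Bin Mul (Reg d) (Reg d))) \<and>
        wp w ?body (clen ?body) (Inv (Suc i)) (\<rho>, \<mu>)"
      using i fits \<rho> by (auto simp: eval_arith simp del: eval.simps(3) sem.simps intro!: wp_sem)
  next
    fix \<rho> \<mu>
    assume "Inv (n * n) (\<rho>, \<mu>)"
    then show "\<not> holds Less (eval w \<rho> \<mu> (Reg 6)) (eval w \<rho> \<mu> (Bin Mul (Reg d) (Reg d))) \<and>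
        (case (\<rho>, \<mu>) of (r', m') \<Rightarrow> off_loop r r' \<and> m' = filled a n f m)"
      using d fits
      by (auto simp: Inv_def eval_arith off_loop_def part_def filled_def fun_eq_iff simp del: eval.simps(3))
  qed
  then have "wp w (fill d b e) (clen (Assign 6 (Num 0)) +
      (n * n * (clen ?body + (elen (Reg 6) + elen (Bin Mul (Reg d) (Reg d)) + 3)) +
        (elen (Reg 6) + elen (Bin Mul (Reg d) (Reg d)) + 3)))
      (\<lambda>(r', m'). off_loop r r' \<and> m' = filled a n f m) (r, m)"
    unfolding fill_def by (intro wp_sem_Seq) simp_all
  then show ?thesis
    by (rule wp_mono) (auto simp: algebra_simps)
qed

section \<open>Colored graphs and binary search\<close>

text \<open>An instruction stores into at most one cell. Hence an algorithm that must change many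
  cells is slow, which is the source of the lower bound on \<open>T\<close>.\<close>

lemma card_changed:
  "finite {y. mem ((step w P ^^ k) c) y \<noteq> mem c y} \<and> card {y. mem ((step w P ^^ k) c) y \<noteq> mem c y} \<le> k"
proof (induction k)
  case (Suc k)
  let ?d = "(step w P ^^ k) c"
  have "\<exists>a. \<forall>y. y \<noteq> a \<longrightarrow> mem (step w P ?d) y = mem ?d y"
    by (cases ?d; cases "P ! pc ?d") (auto simp: step_def)
  then obtain a where a: "\<And>y. y \<noteq> a \<Longrightarrow> mem (step w P ?d) y = mem ?d y"
    by blast
  let ?S = "{y. mem ?d y \<noteq> mem c y}"
  have sub: "{y. mem ((step w P ^^ Suc k) c) y \<noteq> mem c y} \<subseteq> insert a ?S"
    using a by fastforce
  have "card (insert a ?S) \<le> Suc k"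
    using Suc card_insert_le_m1 [of "Suc k" ?S a] by simp
  with Suc sub show ?case
    by (meson card_mono finite.insertI finite_subset le_trans)
qed simp

section \<open>Graphs given by color matrices\<close>

definition matrix_edges :: "nat \<Rightarrow> (nat \<Rightarrow> nat \<Rightarrow> nat) \<Rightarrow> nat set set" where
  "matrix_edges n f = {{u, v} | u v. u < n \<and> v < n \<and> f u v \<noteq> 0}"

text \<open>An edge is an unordered pair; \<open>Min\<close> and \<open>Max\<close> choose an order
  of its ends, and for a symmetric matrix the choice does not matter.\<close>

definition matrix_color :: "(nat \<Rightarrow> nat \<Rightarrow> nat) \<Rightarrow> nat set \<Rightarrow> nat" where
  "matrix_color f e = f (Min e) (Max e)"

locale color_matrix =
  fixes n :: nat and f :: "nat \<Rightarrow> nat \<Rightarrow> nat"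
  assumes sym: "f u v = f v u" and irrefl: "f u u = 0"
    and colors: "u < n \<Longrightarrow> v < n \<Longrightarrow> f u v \<le> n ^ 2"
begin

lemma edge_iff: "{u, v} \<in> matrix_edges n f \<longleftrightarrow> u < n \<and> v < n \<and> f u v \<noteq> 0"
  using sym by (auto simp: matrix_edges_def doubleton_eq_iff)

lemma color_eq: "matrix_color f {u, v} = f u v"
  using sym by (simp add: matrix_color_def min_def max_def)

lemma graph: "edge_colored_graph n (matrix_edges n f) (matrix_color f)"
proof -
  have "u \<noteq> v" if "f u v \<noteq> 0" for u v
    using that irrefl by auto
  then show ?thesis
    using colors by (auto simp: edge_colored_graph_def matrix_edges_def color_eq Suc_le_eq)
qed

lemma graph_input_eq: "graph_input n (matrix_edges n f) (matrix_color f) = row_major n f"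
proof -
  have "0 < n" if "a < n * n" for a
    using that by (cases n) auto
  then show ?thesis
    by (auto simp: graph_input_def row_major_def edge_iff color_eq less_mult_imp_div_less)
qed

lemma in_mono_triangle_iff:
  assumes "u < n" "v < n" "f u v \<noteq> 0"
  shows "in_mono_triangle (matrix_edges n f) (matrix_color f) {u, v} \<longleftrightarrow>
    (\<exists>x<n. f u x = f u v \<and> f v x = f u v)" (is "?l \<longleftrightarrow> ?r")
proof
  assume ?l
  then show ?r
    unfolding in_mono_triangle_def edge_iff color_eq
    by (metis doubleton_eq_iff sym)
next
  assume ?r
  then obtain x where x: "x < n" "f u x = f u v" "f v x = f u v"
    by blast
  then have "distinct [u, v, x]"
    using assms irrefl by auto
  then show ?l
    using x assms unfolding in_mono_triangle_def edge_iff color_eq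
    by (intro exI [of _ u] exI [of _ v] exI [of _ x]) auto
qed

end

lemma row_col_less:
  fixes i j n :: nat
  assumes "i < n" "j < n"
  shows "i * n + j < n * n"
proof -
  have "i * n + j < Suc i * n"
    using assms by simp
  also have "\<dots> \<le> n * n"
    using assms by (intro mult_le_mono1) simp
  finally show ?thesis .
qed

lemma AE_Mono_Triangle_lower_bound:
  assumes "\<And>E col. edge_colored_graph n E col \<Longrightarrow>
      run_within w P n (graph_input n E col) t
        (\<lambda>m. \<forall>u<n. \<forall>v<n. {u, v} \<in> E \<longrightarrow>
          m (u * n + v) = (if in_mono_triangle E col {u, v} then 1 else 0))"
    and "2 \<le> n"
  shows "real (n * (n - 1)) \<le> t"
proof -
  define f :: "nat \<Rightarrow> nat \<Rightarrow> nat" where "f u v = (if u = v then 0 else 2)" for u v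
  have "2 \<le> n ^ 2"
    using assms(2) power_increasing [of 1 2 n] by simp
  then interpret color_matrix n f
    by unfold_locales (auto simp: f_def)
  let ?c = "init n (row_major n f)"
  obtain k where k: "real k \<le> t" and result: "\<forall>u<n. \<forall>v<n. {u, v} \<in> matrix_edges n f \<longrightarrow>
      mem ((step w P ^^ k) ?c) (u * n + v) =
        (if in_mono_triangle (matrix_edges n f) (matrix_color f) {u, v} then 1 else 0)"
    using assms(1) [OF graph] unfolding run_within_def graph_input_eq by blast
  have out: "mem ((step w P ^^ k) ?c) (u * n + v) \<le> 1" if "u < n" "v < n" "u \<noteq> v" for u v
    using result that by (simp add: edge_iff f_def)
  let ?D = "SIGMA u:{..<n}. {..<n} - {u}"
  have unique: "u = u' \<and> v = v'" if "v < n" "v' < n" "u * n + v = u' * n + v'" for u v u' v'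
  proof -
    have "(u * n + v) div n = u" "(u * n + v) mod n = v"
      "(u' * n + v') div n = u'" "(u' * n + v') mod n = v'"
      using that(1,2) by simp_all
    then show ?thesis
      unfolding that(3) by simp
  qed
  have changed: "mem ((step w P ^^ k) ?c) (u * n + v) \<noteq> mem ?c (u * n + v)"
    if "u < n" "v < n" "u \<noteq> v" for u v
  proof -
    have "mem ?c (u * n + v) = 2"
      using that row_col_less [OF that(1,2)] by (simp add: init_def row_major_def f_def)
    with out [OF that] show ?thesis
      by simp
  qed
  have "inj_on (\<lambda>(u, v). u * n + v) ?D"
  proof (rule inj_onI)
    fix x y
    assume "x \<in> ?D" "y \<in> ?D" "(\<lambda>(u, v). u * n + v) x = (\<lambda>(u, v). u * n + v) y"
    then show "x = y"
      using unique [of "snd x" "snd y" "fst x" "fst y"] by (auto simp: prod_eq_iff)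
  qed
  moreover have "(\<lambda>(u, v). u * n + v) ` ?D \<subseteq> {y. mem ((step w P ^^ k) ?c) y \<noteq> mem ?c y}"
    using changed by auto
  ultimately have "card ?D \<le> card {y. mem ((step w P ^^ k) ?c) y \<noteq> mem ?c y}"
    using card_changed [where c = ?c] by (meson card_inj_on_le)
  also have "\<dots> \<le> k"
    using card_changed by blast
  finally have "n * (n - 1) \<le> k"
    by simp
  with k show ?thesis
    by linarith
qed

text \<open>
  A tripartite graph whose parts have \<open>s\<close> vertices; the vertices from \<open>3 * s\<close> on are isolated.
\<close>

definition tripartite_up :: "nat \<Rightarrow> (nat \<Rightarrow> nat \<Rightarrow> nat) \<Rightarrow> (nat \<Rightarrow> nat \<Rightarrow> nat) \<Rightarrow>
    (nat \<Rightarrow> nat \<Rightarrow> nat) \<Rightarrow> nat \<Rightarrow> nat \<Rightarrow> nat" where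
  "tripartite_up s f g h u v =
     (if u div s = 0 then
        if v div s = 1 then f (u mod s) (v mod s)
        else if v div s = 2 then g (u mod s) (v mod s) else 0
      else if u div s = 1 then if v div s = 2 then h (u mod s) (v mod s) else 0
      else 0)"

definition tripartite :: "nat \<Rightarrow> (nat \<Rightarrow> nat \<Rightarrow> nat) \<Rightarrow> (nat \<Rightarrow> nat \<Rightarrow> nat) \<Rightarrow>
    (nat \<Rightarrow> nat \<Rightarrow> nat) \<Rightarrow> nat \<Rightarrow> nat \<Rightarrow> nat" where
  "tripartite s f g h u v =
     (if u < v then tripartite_up s f g h u v else tripartite_up s f g h v u)"

lemma tripartite_sym: "tripartite s f g h u v = tripartite s f g h v u"
  by (auto simp: tripartite_def not_less_iff_gr_or_eq)

lemma tripartite_irrefl: "tripartite s f g h u u = 0"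
  by (simp add: tripartite_def tripartite_up_def)

lemma tripartite_le:
  assumes "0 < s" "\<And>i j. i < s \<Longrightarrow> j < s \<Longrightarrow> f i j \<le> b \<and> g i j \<le> b \<and> h i j \<le> b"
  shows "tripartite s f g h u v \<le> b"
  using assms by (auto simp: tripartite_def tripartite_up_def)

text \<open>No edge runs inside a part, so a common neighbor of a vertex of the first part and one
  of the second lies in the third. The assumption \<open>f i j \<noteq> 0\<close> keeps non-edges
  from being counted as neighbors of the right color.\<close>

lemma tripartite_triangle_iff:
  assumes s: "0 < s" "3 * s \<le> n" and ij: "i < s" "j < s" "f i j \<noteq> 0"
  shows "(\<exists>x<n. tripartite s f g h i x = f i j \<and> tripartite s f g h (s + j) x = f i j) \<longleftrightarrow>
    (\<exists>y<s. g i y = f i j \<and> h j y = f i j)" (is "?l \<longleftrightarrow> ?r")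
proof
  assume ?l
  then obtain x where x: "tripartite s f g h i x = f i j" "tripartite s f g h (s + j) x = f i j"
    by blast
  have cls: "i div s = 0" "(s + j) div s = 1" "i mod s = i" "(s + j) mod s = j"
    using ij s by simp_all
  have "x div s = 2"
    using x ij cls by (auto simp: tripartite_def tripartite_up_def split: if_splits)
  moreover then have "s + j < x"
    using ij div_mult_mod_eq [of x s] by simp
  ultimately show ?r
    using x ij cls s by (intro exI [of _ "x mod s"]) (auto simp: tripartite_def tripartite_up_def split: if_splits)
next
  assume ?r
  then obtain y where y: "y < s" "g i y = f i j" "h j y = f i j"
    by blast
  have cls: "i div s = 0" "(s + j) div s = 1" "i mod s = i" "(s + j) mod s = j"
    "(2 * s + y) div s = 2" "(2 * s + y) mod s = y"
    using ij s y by simp_all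
  have "i < 2 * s + y" "s + j < 2 * s + y" "2 * s + y < n"
    using ij s y by simp_all
  then show ?l
    using y cls by (intro exI [of _ "2 * s + y"]) (simp add: tripartite_def tripartite_up_def)
qed

lemma tripartite_first_second:
  "0 < s \<Longrightarrow> i < s \<Longrightarrow> j < s \<Longrightarrow> tripartite s f g h i (s + j) = f i j"
  by (simp add: tripartite_def tripartite_up_def)

text \<open>
  The state of a binary search for the minimum of \<open>S\<close> below \<open>n\<close>: the interval number \<open>v\<close> of
  length \<open>p\<close> is the first one that may contain it, where \<open>n\<close> is a sentinel.
\<close>

definition search :: "nat \<Rightarrow> (nat \<Rightarrow> bool) \<Rightarrow> nat \<Rightarrow> nat \<Rightarrow> bool" where
  "search n S p v \<longleftrightarrow> (\<forall>k<n. S k \<longrightarrow> v \<le> k div p) \<and> (\<exists>k\<le>n. (k = n \<or> S k) \<and> k div p \<le> v)"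

lemma search_init: "n < p \<Longrightarrow> search n S p 0"
  by (auto simp: search_def)

text \<open>Interval \<open>v\<close> splits into \<open>2 * v\<close> and \<open>2 * v + 1\<close>,
  and only hits by elements of \<open>S\<close> are tested. If \<open>S\<close> is empty below
  \<open>n\<close>, the number may run past the sentinel; this is why \<open>search\<close> uses
  inequalities and why \<open>search_final\<close> needs \<open>min v n\<close>.\<close>

lemma search_step:
  assumes "search n S (2 * p) v"
  shows "search n S p (2 * v + (if \<exists>k<n. S k \<and> k div p = 2 * v then 0 else 1))"
proof -
  have half: "k div (2 * p) = k div p div 2" for k
    by (metis div_mult2_eq mult.commute)
  have lower: "v \<le> k div p div 2" if "k < n" "S k" for k
    using assms that by (auto simp: search_def half)
  obtain l where l: "l \<le> n" "l = n \<or> S l" "l div p div 2 \<le> v"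
    using assms by (auto simp: search_def half)
  show ?thesis
  proof (cases "\<exists>k<n. S k \<and> k div p = 2 * v")
    case True
    then obtain k where "k < n" "S k" "k div p = 2 * v"
      by blast
    moreover have "2 * v \<le> k div p" if "k < n" "S k" for k
      using lower [OF that] by linarith
    ultimately show ?thesis
      using True unfolding search_def by (auto intro!: exI [of _ k])
  next
    case False
    have "2 * v + 1 \<le> k div p" if "k < n" "S k" for k
    proof -
      have "k div p \<noteq> 2 * v"
        using False that by blast
      then show ?thesis
        using lower [OF that] by linarith
    qed
    moreover have "l div p \<le> 2 * v + 1"
      using l(3) by linarith
    ultimately show ?thesis
      using False l(1,2) unfolding search_def by auto
  qed
qed

lemma search_final:
  assumes "search n (\<lambda>k. A i k \<and> B k j) 1 v"
  shows "min v n = witness_word n (min_witness n A B i j)"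
proof -
  let ?S = "{enat k | k. k < n \<and> A i k \<and> B k j}"
  have fin: "finite ?S"
    by simp
  show ?thesis
  proof (cases "\<exists>k<n. A i k \<and> B k j")
    case True
    obtain l where l: "l \<le> n" "l = n \<or> A i l \<and> B l j" "l \<le> v"
      using assms by (auto simp: search_def)
    have v2: "v \<le> k" if "k < n" "A i k \<and> B k j" for k
      using assms that by (auto simp: search_def)
    obtain k where "k < n" "A i k \<and> B k j"
      using True by blast
    then have "l < n"
      using v2 l(3) by (meson le_less_trans)
    then have "l = v"
      using l v2 [of l] by auto
    with l \<open>l < n\<close> v2 have v: "v < n \<and> A i v \<and> B v j" "\<And>k. k < n \<Longrightarrow> A i k \<and> B k j \<Longrightarrow> v \<le> k"
      by auto
    have "Min (?S \<union> {\<infinity>}) = enat v"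
      using v by (intro Min_eqI) auto
    then show ?thesis
      using v by (simp add: min_witness_def witness_word_def)
  next
    case False
    then have "n \<le> v"
      using assms unfolding search_def by auto
    moreover have "?S = {}"
      using False by blast
    ultimately show ?thesis
      unfolding min_witness_def witness_word_def by (simp del: Collect_empty_eq)
  qed
qed

section \<open>The reduction\<close>

declare eval.simps(3) [simp del] eval_arith [simp]

text \<open>
  Registers 0 to 5 contain the dimension \<open>n\<close> of the matrices, the number \<open>N\<close> of vertices, the
  block size \<open>s\<close>, the interval length \<open>p\<close>, the number \<open>2 ^ v\<close> of words of the interpreted
  program and the address of its memory. The matrix of the interval numbers starts at \<open>2 * n * n\<close>.
  Registers 13 to 15 contain the block numbers of the rows, the columns and the witnesses.
\<close>

definition cell :: "exp \<Rightarrow> exp \<Rightarrow> exp" where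
  "cell i j = Bin Add (Bin Mul (Num 2) (Bin Mul (Reg 0) (Reg 0))) (Bin Add (Bin Mul i (Reg 0)) j)"

definition even_part :: "exp \<Rightarrow> exp" where
  "even_part e = Bin Mul (Num 2) (Bin Div e (Num 2))"

definition in_block :: "nat \<Rightarrow> exp \<Rightarrow> exp" where
  "in_block x u = Bin Add (Bin Mul (Reg x) (Reg 2)) (Bin Mod u (Reg 2))"

text \<open>Five blocks of \<open>s\<close> indices can extend beyond \<open>n\<close>; the value 0
  turns the surplus pairs into non-edges.\<close>

definition if_in_range :: "exp \<Rightarrow> exp \<Rightarrow> exp \<Rightarrow> exp" where
  "if_in_range i j e = Cond Less i (Reg 0) (Cond Less j (Reg 0) e (Num 0)) (Num 0)"

definition row_col_exp :: "exp \<Rightarrow> exp \<Rightarrow> exp" where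
  "row_col_exp i j = if_in_range i j
     (Cond Less (even_part (Mem (cell i j))) (Reg 0)
       (Bin Add (even_part (Mem (cell i j))) (Num 1)) (Bin Add (Reg 0) (Num 1)))"

definition row_witness_exp :: "exp \<Rightarrow> exp \<Rightarrow> exp" where
  "row_witness_exp i k = if_in_range i k
     (Cond Equal (Mem (Bin Add (Bin Mul i (Reg 0)) k)) (Num 1)
       (Bin Add (Bin Div k (Reg 3)) (Num 1)) (Num 0))"

definition col_witness_exp :: "exp \<Rightarrow> exp \<Rightarrow> exp" where
  "col_witness_exp j k = if_in_range j k
     (Cond Equal (Mem (Bin Add (Bin Mul (Reg 0) (Reg 0)) (Bin Add (Bin Mul k (Reg 0)) j))) (Num 1)
       (Bin Add (Bin Div k (Reg 3)) (Num 1)) (Num 0))"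

definition color_up_exp :: "exp \<Rightarrow> exp \<Rightarrow> exp" where
  "color_up_exp u v =
     Cond Equal (Bin Div u (Reg 2)) (Num 0)
       (Cond Equal (Bin Div v (Reg 2)) (Num 1) (row_col_exp (in_block 13 u) (in_block 14 v))
         (Cond Equal (Bin Div v (Reg 2)) (Num 2) (row_witness_exp (in_block 13 u) (in_block 15 v))
           (Num 0)))
       (Cond Equal (Bin Div u (Reg 2)) (Num 1)
         (Cond Equal (Bin Div v (Reg 2)) (Num 2) (col_witness_exp (in_block 14 u) (in_block 15 v))
           (Num 0))
         (Num 0))"

definition color_exp :: exp where
  "color_exp = Cond Less (Reg 9) (Reg 10)
     (color_up_exp (Reg 9) (Reg 10)) (color_up_exp (Reg 10) (Reg 9))"

text \<open>The answer for row \<open>i\<close> and column \<open>j\<close> is in the cell of the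
  vertices \<open>i mod s\<close> and \<open>s + j mod s\<close>. It concerns this entry only if
  both indices belong to the current blocks, hence the two tests before the answer is read.\<close>

definition update_exp :: exp where
  "update_exp = (let c = Mem (cell (Reg 9) (Reg 10)) in
     Cond Equal (Bin Div (Reg 9) (Reg 2)) (Reg 13)
       (Cond Equal (Bin Div (Reg 10) (Reg 2)) (Reg 14)
         (Cond Equal (Mem (Bin Add (Reg 5) (Bin Add (Bin Mul (Bin Mod (Reg 9) (Reg 2)) (Reg 1))
             (Bin Add (Reg 2) (Bin Mod (Reg 10) (Reg 2)))))) (Num 1)
           (even_part c) c) c) c)"

definition interval_base :: exp where
  "interval_base = Bin Mul (Num 2) (Bin Mul (Reg 0) (Reg 0))"

definition block_step :: "program \<Rightarrow> nat \<Rightarrow> com" where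
  "block_step P R =
     Seq (Assign 13 (Bin Div (Reg 7) (Num 25)))
     (Seq (Assign 14 (Bin Mod (Bin Div (Reg 7) (Num 5)) (Num 5)))
     (Seq (Assign 15 (Bin Mod (Reg 7) (Num 5)))
     (Seq (fill 1 (Reg 5) color_exp)
     (Seq (call P R)
     (Seq (fill 0 interval_base update_exp)
     (Seq (Assign 5 (Bin Add (Reg 5) (Reg 4))) (Assign 7 (Bin Add (Reg 7) (Num 1)))))))))"

definition block_cost :: "program \<Rightarrow> nat \<Rightarrow> nat" where
  "block_cost P R = call_cost P R + elen color_exp + elen interval_base + elen update_exp + 100"

text \<open>The dimension is fixed, and \<open>T\<close> is the time bound for
  \<open>max n 3\<close> vertices. The bound 128 lets the numerals of the reduction, at most 125,
  fit into a word. The bound \<open>4 * 2 ^ v\<close> leaves room for three matrices below the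
  windows, each with at most \<open>2 ^ v\<close> cells.\<close>

locale reduction =
  fixes n w v R :: nat and P :: program and A B :: "nat \<Rightarrow> nat \<Rightarrow> bool" and T :: real
  assumes n_pos: "0 < n"
    and P_length: "length P < 2 ^ w"
    and P_regs: "a \<in> set P \<Longrightarrow> instr_regs a \<subseteq> {..<R}"
    and P_solves: "edge_colored_graph (max n 3) E col \<Longrightarrow>
      run_within v P (max n 3) (graph_input (max n 3) E col) T
        (\<lambda>m. \<forall>x<max n 3. \<forall>y<max n 3. {x, y} \<in> E \<longrightarrow>
          m (x * max n 3 + y) = (if in_mono_triangle E col {x, y} then 1 else 0))"
    and w_large: "4 * 2 ^ v \<le> (2 :: nat) ^ w" "128 \<le> (2 :: nat) ^ w"
begin

definition N :: nat where "N = max n 3"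
definition s :: nat where "s = N div 3"

text \<open>From \<open>N \<le> 3 * s + 2\<close> and \<open>1 \<le> s\<close> follows
  \<open>N \<le> 5 * s\<close>. For \<open>N = 5\<close> this is an equality, so four blocks would
  not do.\<close>

lemma N_s: "0 < s" "3 * s \<le> N" "n \<le> 5 * s" "n \<le> N" "3 \<le> N" "s \<le> N" "5 * s \<le> 2 * N"
proof -
  have "N = 3 * (N div 3) + N mod 3" "N mod 3 \<le> 2"
    by auto
  moreover have "3 * (N div 3) \<le> N"
    by simp
  moreover have "3 \<le> N" "n \<le> N"
    by (auto simp: N_def)
  moreover from this have "1 \<le> N div 3"
    by (simp add: Suc_le_eq div_greater_zero_iff)
  ultimately show "0 < s" "3 * s \<le> N" "n \<le> 5 * s" "n \<le> N" "3 \<le> N" "s \<le> N" "5 * s \<le> 2 * N"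
    unfolding s_def by linarith+
qed

text \<open>A run presupposes \<open>input_fits\<close>, so the edgeless graph already shows that
  the color matrix fits into a window.\<close>

lemma N_fits: "N * N \<le> 2 ^ v" "N < 2 ^ v"
proof -
  have "edge_colored_graph N {} (\<lambda>_. 0)"
    by (simp add: edge_colored_graph_def)
  from P_solves [folded N_def, OF this] show "N * N \<le> 2 ^ v" "N < 2 ^ v"
    by (auto simp: run_within_def input_fits_def graph_input_def row_major_def)
qed

lemma n_fits: "n * n \<le> 2 ^ v" "3 * (n * n) \<le> 2 ^ w" "n + 1 < 2 ^ w" "5 * s \<le> 2 ^ w" "N < 2 ^ w"
  "n * n < 2 ^ w" "N * N < 2 ^ w" "2 * (n * n) < 2 ^ w"
proof -
  have "n * n \<le> N * N"
    using N_s by (intro mult_mono) auto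
  then show "n * n \<le> 2 ^ v" "3 * (n * n) \<le> 2 ^ w" "n + 1 < 2 ^ w" "5 * s \<le> 2 ^ w" "N < 2 ^ w"
    "n * n < 2 ^ w" "N * N < 2 ^ w" "2 * (n * n) < 2 ^ w"
    using N_fits N_s w_large n_pos by auto
qed

section \<open>Memory contents and the graphs of the calls\<close>

definition view :: "(nat \<Rightarrow> nat \<Rightarrow> nat) \<Rightarrow> nat \<Rightarrow> (nat \<Rightarrow> nat) \<Rightarrow> (nat \<Rightarrow> nat) \<Rightarrow> bool" where
  "view V p r m \<longleftrightarrow> r 0 = n \<and> r 1 = N \<and> r 2 = s \<and> r 3 = p \<and>
     (\<forall>i<n. \<forall>k<n. m (i * n + k) = of_bool (A i k)) \<and>
     (\<forall>k<n. \<forall>j<n. m (n * n + (k * n + j)) = of_bool (B k j)) \<and>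
     (\<forall>i<n. \<forall>j<n. m (2 * (n * n) + (i * n + j)) = V i j \<and> V i j < 2 ^ w)"

text \<open>The condition \<open>view\<close> is separate because it persists while a graph is
  written and during a call, whereas the zeros from \<open>b\<close> on do not.\<close>

definition layout :: "(nat \<Rightarrow> nat \<Rightarrow> nat) \<Rightarrow> nat \<Rightarrow> nat \<Rightarrow> (nat \<Rightarrow> nat) \<Rightarrow> (nat \<Rightarrow> nat) \<Rightarrow> bool" where
  "layout V p b r m \<longleftrightarrow> view V p r m \<and> r 4 = 2 ^ v \<and> r 5 = b \<and> (\<forall>y\<ge>b. m y = 0)"

text \<open>
  Interval numbers of witnesses are smaller than \<open>n\<close>, so capping an interval number at \<open>n\<close> keeps
  the colors in range and creates no new triangles.
\<close>

definition row_col :: "(nat \<Rightarrow> nat \<Rightarrow> nat) \<Rightarrow> nat \<Rightarrow> nat \<Rightarrow> nat \<Rightarrow> nat \<Rightarrow> nat" where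
  "row_col V a b i j =
     (let i' = a * s + i; j' = b * s + j in
      if i' < n \<and> j' < n then min (2 * (V i' j' div 2)) n + 1 else 0)"

definition row_witness :: "nat \<Rightarrow> nat \<Rightarrow> nat \<Rightarrow> nat \<Rightarrow> nat \<Rightarrow> nat" where
  "row_witness p a c i k =
     (let i' = a * s + i; k' = c * s + k in
      if i' < n \<and> k' < n \<and> A i' k' then k' div p + 1 else 0)"

definition col_witness :: "nat \<Rightarrow> nat \<Rightarrow> nat \<Rightarrow> nat \<Rightarrow> nat \<Rightarrow> nat" where
  "col_witness p b c j k =
     (let j' = b * s + j; k' = c * s + k in
      if j' < n \<and> k' < n \<and> B k' j' then k' div p + 1 else 0)"

definition block_color :: "(nat \<Rightarrow> nat \<Rightarrow> nat) \<Rightarrow> nat \<Rightarrow> nat \<Rightarrow> nat \<Rightarrow> nat \<Rightarrow> nat" where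
  "block_color V p z =
     (let a = z div 25; b = z div 5 mod 5; c = z mod 5 in
      tripartite s (row_col V a b) (row_witness p a c) (col_witness p b c))"

lemma block_color_le: "block_color V p z x y \<le> N ^ 2"
proof -
  have "n + 1 \<le> N + N" "2 * N \<le> N * N"
    using N_s n_pos by (auto intro: mult_le_mono1)
  then have le: "n + 1 \<le> N ^ 2"
    unfolding power2_eq_square by linarith
  then have "k div p + 1 \<le> N ^ 2" if "k < n" for k
    using div_le_dividend [of k p] that by linarith
  moreover have "min k n + 1 \<le> N ^ 2" for k
    using le by linarith
  ultimately show ?thesis
    unfolding block_color_def Let_def row_col_def row_witness_def col_witness_def using N_s(1)
    by (intro tripartite_le) auto
qed

lemma color_matrix_block_color: "color_matrix N (block_color V p z)"
proof
  show "block_color V p z x y = block_color V p z y x" for x y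
    unfolding block_color_def Let_def by (rule tripartite_sym)
  show "block_color V p z x x = 0" for x
    unfolding block_color_def Let_def by (rule tripartite_irrefl)
qed (rule block_color_le)

sublocale color_matrix N "block_color V p z" for V p z
  by (rule color_matrix_block_color)

text \<open>
  An odd value \<open>2 * q + 1\<close> means that no witness in interval \<open>2 * q\<close> has been found yet in the
  current round. The base 5 digits of \<open>z\<close> are the block numbers of the row, the column and the
  witness that call \<open>z\<close> deals with.
\<close>

definition improve :: "(nat \<Rightarrow> nat \<Rightarrow> nat) \<Rightarrow> nat \<Rightarrow> nat \<Rightarrow> nat \<Rightarrow> nat \<Rightarrow> nat" where
  "improve V p z i j =
     (if \<exists>k<n. A i k \<and> B k j \<and> k div p = 2 * (V i j div 2) \<and>
           25 * (i div s) + 5 * (j div s) + k div s = z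
      then 2 * (V i j div 2) else V i j)"

lemma digits:
  fixes a b c z :: nat
  assumes "b < 5" "c < 5"
  shows "25 * a + 5 * b + c = z \<longleftrightarrow> a = z div 25 \<and> b = z div 5 mod 5 \<and> c = z mod 5"
proof -
  have "z div 5 div 5 = z div 25"
    by (simp flip: div_mult2_eq)
  moreover have "5 * a + b = y \<longleftrightarrow> a = y div 5 \<and> b = y mod 5" for y
    using assms(1) by auto
  moreover have "5 * y + c = z \<longleftrightarrow> y = z div 5 \<and> c = z mod 5" for y
    using assms(2) by auto
  moreover have "25 * a + 5 * b + c = 5 * (5 * a + b) + c"
    by simp
  ultimately show ?thesis
    by metis
qed

lemma div_s_less: "i < n \<Longrightarrow> i div s < 5"
  using N_s by (simp add: div_less_iff_less_mult)

lemma improve_iff: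
  assumes "i < n" "j < n"
  shows "(\<exists>k<n. A i k \<and> B k j \<and> k div p = x \<and> 25 * (i div s) + 5 * (j div s) + k div s = z) \<longleftrightarrow>
    i div s = z div 25 \<and> j div s = z div 5 mod 5 \<and>
    (\<exists>k<n. A i k \<and> B k j \<and> k div p = x \<and> k div s = z mod 5)"
proof -
  have "(\<exists>k<n. A i k \<and> B k j \<and> k div p = x \<and> 25 * (i div s) + 5 * (j div s) + k div s = z) \<longleftrightarrow>
    (\<exists>k<n. A i k \<and> B k j \<and> k div p = x \<and>
      i div s = z div 25 \<and> j div s = z div 5 mod 5 \<and> k div s = z mod 5)"
    using assms by (intro ex_cong1 conj_cong refl digits div_s_less)
  then show ?thesis
    by blast
qed

lemma improve_eq:
  assumes ij: "i < n" "j < n" and blocks: "i div s = z div 25" "j div s = z div 5 mod 5"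
  shows "improve V p z i j =
    (if in_mono_triangle (matrix_edges N (block_color V p z)) (matrix_color (block_color V p z))
        {i mod s, s + j mod s}
     then 2 * (V i j div 2) else V i j)"
    and "{i mod s, s + j mod s} \<in> matrix_edges N (block_color V p z)"
proof -
  let ?a = "z div 25" and ?b = "z div 5 mod 5" and ?c = "z mod 5"
  have lt: "i mod s < s" "j mod s < s" "i mod s < N" "s + j mod s < N"
    using N_s mod_less_divisor [of s i] mod_less_divisor [of s j] by linarith+
  have i: "?a * s + i mod s = i" and j: "?b * s + j mod s = j"
    using blocks by (metis div_mult_mod_eq)+
  have f: "row_col V ?a ?b (i mod s) (j mod s) = min (2 * (V i j div 2)) n + 1"
    using ij by (simp add: row_col_def i j)
  then have color: "block_color V p z (i mod s) (s + j mod s) = min (2 * (V i j div 2)) n + 1"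
    using lt N_s by (simp add: block_color_def Let_def tripartite_first_second)
  then show "{i mod s, s + j mod s} \<in> matrix_edges N (block_color V p z)"
    using lt by (simp add: edge_iff)
  have "in_mono_triangle (matrix_edges N (block_color V p z)) (matrix_color (block_color V p z))
        {i mod s, s + j mod s} \<longleftrightarrow>
      (\<exists>y<s. row_witness p ?a ?c (i mod s) y = min (2 * (V i j div 2)) n + 1 \<and>
        col_witness p ?b ?c (j mod s) y = min (2 * (V i j div 2)) n + 1)"
  proof -
    define x where "x = min (2 * (V i j div 2)) n + 1"
    have x: "row_col V ?a ?b (i mod s) (j mod s) = x" "x \<noteq> 0"
      using f by (simp_all add: x_def)
    have tri: "in_mono_triangle (matrix_edges N (block_color V p z)) (matrix_color (block_color V p z))
        {i mod s, s + j mod s} \<longleftrightarrow>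
      (\<exists>y<N. block_color V p z (i mod s) y = block_color V p z (i mod s) (s + j mod s) \<and>
        block_color V p z (s + j mod s) y = block_color V p z (i mod s) (s + j mod s))"
      using color by (intro in_mono_triangle_iff lt) simp
    show ?thesis
      unfolding tri color x_def [symmetric]
      using tripartite_triangle_iff [OF N_s(1,2) lt(1,2), of "row_col V ?a ?b", unfolded x, OF x(2)]
      unfolding block_color_def Let_def .
  qed
  also have "\<dots> \<longleftrightarrow> (\<exists>y<s. ?c * s + y < n \<and> A i (?c * s + y) \<and> B (?c * s + y) j \<and>
      (?c * s + y) div p = 2 * (V i j div 2))" (is "_ \<longleftrightarrow> ?r")
  proof -
    have "k div p < n" if "k < n" for k
      using that by (meson div_le_dividend le_less_trans)
    then have "k < n \<Longrightarrow> k div p = min x n \<longleftrightarrow> k div p = x" for k x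
      by (metis less_irrefl min_def min_less_iff_conj)
    then have "row_witness p ?a ?c (i mod s) y = min x n + 1 \<and>
        col_witness p ?b ?c (j mod s) y = min x n + 1 \<longleftrightarrow>
        ?c * s + y < n \<and> A i (?c * s + y) \<and> B (?c * s + y) j \<and> (?c * s + y) div p = x" for x y
      using ij unfolding row_witness_def col_witness_def Let_def i j by (auto split: if_splits)
    then show ?thesis
      by simp
  qed
  also have "\<dots> \<longleftrightarrow> (\<exists>k<n. A i k \<and> B k j \<and> k div p = 2 * (V i j div 2) \<and> k div s = ?c)"
    (is "_ \<longleftrightarrow> ?l")
  proof
    assume ?r
    then obtain y where y: "y < s" "?c * s + y < n" "A i (?c * s + y)" "B (?c * s + y) j"
      "(?c * s + y) div p = 2 * (V i j div 2)"
      by blast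
    then show ?l
      by (intro exI [of _ "?c * s + y"]) simp
  next
    assume ?l
    then obtain k where k: "k < n" "A i k" "B k j" "k div p = 2 * (V i j div 2)" "k div s = ?c"
      by blast
    have "?c * s + k mod s = k"
      using k(5) by (metis div_mult_mod_eq)
    then show ?r
      using k N_s by (intro exI [of _ "k mod s"]) simp
  qed
  finally show "improve V p z i j =
    (if in_mono_triangle (matrix_edges N (block_color V p z)) (matrix_color (block_color V p z))
        {i mod s, s + j mod s}
     then 2 * (V i j div 2) else V i j)"
    using blocks unfolding improve_def improve_iff [OF ij] by simp
qed

lemma improve_other:
  assumes "i < n" "j < n" "\<not> (i div s = z div 25 \<and> j div s = z div 5 mod 5)"
  shows "improve V p z i j = V i j"
  using assms unfolding improve_def improve_iff [OF assms(1,2)] by auto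

section \<open>Values of the expressions of the reduction\<close>

lemma w_pos [simp]: "0 < w"
  using w_large(2) by (intro Nat.gr0I) simp

lemma small_mod [simp]: "k \<le> 127 \<Longrightarrow> k mod 2 ^ w = k" for k :: nat
  using w_large by simp

lemma div_mod_word [simp]: "x < 2 ^ w \<Longrightarrow> x div y mod 2 ^ w = x div y" for x y :: nat
  by (rule mod_less) (rule le_less_trans [OF div_le_dividend])

lemma mod_mod_word [simp]: "x < 2 ^ w \<Longrightarrow> x mod y mod 2 ^ w = x mod y" for x y :: nat
  by (rule mod_less) (rule le_less_trans [OF mod_less_eq_dividend])

lemma eval_cell:
  assumes "r 0 = n" "eval w r m i < n" "eval w r m j < n"
  shows "eval w r m (cell i j) = 2 * (n * n) + (eval w r m i * n + eval w r m j)"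
proof -
  have "2 * (n * n) + (eval w r m i * n + eval w r m j) < 2 ^ w"
    using row_col_less [OF assms(2,3)] n_fits by linarith
  then show ?thesis
    by (simp add: cell_def assms(1) mod_simps)
qed

lemma eval_even_part:
  assumes "eval w r m e < 2 ^ w"
  shows "eval w r m (even_part e) = 2 * (eval w r m e div 2)"
proof -
  have "2 * (eval w r m e div 2) < 2 ^ w"
    using assms by linarith
  then show ?thesis
    using assms by (simp add: even_part_def)
qed

lemma eval_in_block:
  assumes "r 2 = s" "r x < 5" "eval w r m u < 2 ^ w"
  shows "eval w r m (in_block x u) = r x * s + eval w r m u mod s" "r x * s + eval w r m u mod s < 5 * s"
proof -
  have "r x * s \<le> 4 * s"
    using assms(2) by (intro mult_le_mono1) simp
  then show *: "r x * s + eval w r m u mod s < 5 * s"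
    using mod_less_divisor [OF N_s(1), of "eval w r m u"] by linarith
  then have "r x * s + eval w r m u mod s < 2 ^ w"
    using n_fits by linarith
  then show "eval w r m (in_block x u) = r x * s + eval w r m u mod s"
    using assms by (simp add: in_block_def mod_simps)
qed

lemma eval_row_col:
  assumes v: "view V p r m" and u: "r 13 < 5" "r 14 < 5" "eval w r m u < 2 ^ w" "eval w r m u' < 2 ^ w"
  shows "eval w r m (row_col_exp (in_block 13 u) (in_block 14 u')) =
    row_col V (r 13) (r 14) (eval w r m u mod s) (eval w r m u' mod s)"
proof -
  have r: "r 0 = n" "r 2 = s"
    using v by (auto simp: view_def)
  let ?i = "in_block 13 u" and ?j = "in_block 14 u'"
  note i = eval_in_block(1) [OF r(2) u(1,3)] and j = eval_in_block(1) [OF r(2) u(2,4)]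
  show ?thesis
  proof (cases "eval w r m ?i < n \<and> eval w r m ?j < n")
    case True
    then have c: "eval w r m (Mem (cell ?i ?j)) = V (eval w r m ?i) (eval w r m ?j)"
      "V (eval w r m ?i) (eval w r m ?j) < 2 ^ w"
      using v by (auto simp: eval_cell r view_def)
    then have e: "eval w r m (even_part (Mem (cell ?i ?j))) = 2 * (V (eval w r m ?i) (eval w r m ?j) div 2)"
      by (subst eval_even_part) simp_all
    show ?thesis
      using True n_fits unfolding row_col_exp_def if_in_range_def
      by (simp add: e r row_col_def i j min_def Let_def)
  next
    case False
    then show ?thesis
      unfolding row_col_exp_def if_in_range_def
      by (auto simp add: r row_col_def i j)
  qed
qed

lemma eval_row_witness:
  assumes v: "view V p r m" and u: "r 13 < 5" "r 15 < 5" "eval w r m u < 2 ^ w" "eval w r m u' < 2 ^ w"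
  shows "eval w r m (row_witness_exp (in_block 13 u) (in_block 15 u')) =
    row_witness p (r 13) (r 15) (eval w r m u mod s) (eval w r m u' mod s)"
proof -
  have r: "r 0 = n" "r 2 = s" "r 3 = p"
    using v by (auto simp: view_def)
  let ?i = "in_block 13 u" and ?k = "in_block 15 u'"
  note i = eval_in_block(1) [OF r(2) u(1,3)] and k = eval_in_block(1) [OF r(2) u(2,4)]
  show ?thesis
  proof (cases "eval w r m ?i < n \<and> eval w r m ?k < n")
    case True
    then have "eval w r m ?i * n + eval w r m ?k < 2 ^ w"
      using row_col_less [of "eval w r m ?i" n "eval w r m ?k"] n_fits(6) by linarith
    then have c: "eval w r m (Mem (Bin Add (Bin Mul ?i (Reg 0)) ?k)) = of_bool (A (eval w r m ?i) (eval w r m ?k))"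
      using v True by (simp add: view_def mod_simps)
    have "eval w r m ?k div p + 1 < 2 ^ w" "eval w r m ?k < 2 ^ w"
      using n_fits(3) True div_le_dividend [of "eval w r m ?k" p] by linarith+
    then show ?thesis
      using True unfolding row_witness_exp_def if_in_range_def
      by (simp del: eval.simps(4) add: c r row_witness_def flip: i k)
  next
    case False
    then show ?thesis
      unfolding row_witness_exp_def if_in_range_def
      by (auto simp add: r row_witness_def i k)
  qed
qed

lemma eval_col_witness:
  assumes v: "view V p r m" and u: "r 14 < 5" "r 15 < 5" "eval w r m u < 2 ^ w" "eval w r m u' < 2 ^ w"
  shows "eval w r m (col_witness_exp (in_block 14 u) (in_block 15 u')) =
    col_witness p (r 14) (r 15) (eval w r m u mod s) (eval w r m u' mod s)"
proof -
  have r: "r 0 = n" "r 2 = s" "r 3 = p"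
    using v by (auto simp: view_def)
  let ?j = "in_block 14 u" and ?k = "in_block 15 u'"
  note j = eval_in_block(1) [OF r(2) u(1,3)] and k = eval_in_block(1) [OF r(2) u(2,4)]
  show ?thesis
  proof (cases "eval w r m ?j < n \<and> eval w r m ?k < n")
    case True
    then have "n * n + (eval w r m ?k * n + eval w r m ?j) < 2 ^ w"
      using row_col_less [of "eval w r m ?k" n "eval w r m ?j"] n_fits(8) by linarith
    then have c: "eval w r m (Mem (Bin Add (Bin Mul (Reg 0) (Reg 0)) (Bin Add (Bin Mul ?k (Reg 0)) ?j))) =
        of_bool (B (eval w r m ?k) (eval w r m ?j))"
      using v True by (simp add: view_def mod_simps)
    have "eval w r m ?k div p + 1 < 2 ^ w" "eval w r m ?k < 2 ^ w"
      using n_fits(3) True div_le_dividend [of "eval w r m ?k" p] by linarith+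
    then show ?thesis
      using True unfolding col_witness_exp_def if_in_range_def
      by (simp del: eval.simps(4) add: c r col_witness_def flip: j k)
  next
    case False
    then show ?thesis
      unfolding col_witness_exp_def if_in_range_def
      by (auto simp add: r col_witness_def j k)
  qed
qed

lemma eval_color:
  assumes v: "view V p r m" and z: "r 13 = z div 25" "r 14 = z div 5 mod 5" "r 15 = z mod 5" "z < 125"
    and r: "r 9 < N" "r 10 < N"
  shows "eval w r m color_exp = block_color V p z (r 9) (r 10)"
proof -
  have lt: "r 13 < 5" "r 14 < 5" "r 15 < 5"
    using z by auto
  have "r 2 = s"
    using v by (simp add: view_def)
  then have "eval w r m (color_up_exp u u') =
      tripartite_up s (row_col V (r 13) (r 14)) (row_witness p (r 13) (r 15)) (col_witness p (r 14) (r 15))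
        (eval w r m u) (eval w r m u')"
    if "eval w r m u < 2 ^ w" "eval w r m u' < 2 ^ w" for u u'
    using that unfolding color_up_exp_def tripartite_up_def
    by (simp add: eval_row_col [OF v lt(1,2) that] eval_row_witness [OF v lt(1,3) that]
        eval_col_witness [OF v lt(2,3) that])
  moreover have "r 9 < 2 ^ w" "r 10 < 2 ^ w"
    using r n_fits(5) by linarith+
  ultimately show ?thesis
    unfolding color_exp_def block_color_def Let_def z(1-3) [symmetric] tripartite_def by simp
qed

lemma eval_update:
  assumes regs: "r 0 = n" "r 1 = N" "r 2 = s" and z: "r 13 = z div 25" "r 14 = z div 5 mod 5"
    and V: "m (2 * (n * n) + (r 9 * n + r 10)) = V (r 9) (r 10)" "V (r 9) (r 10) < 2 ^ w"
    and r: "r 9 < n" "r 10 < n" and b: "r 5 + 2 ^ v \<le> 2 ^ w"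
    and out: "\<And>x y. x < N \<Longrightarrow> y < N \<Longrightarrow> {x, y} \<in> matrix_edges N (block_color V p z) \<Longrightarrow>
      m (r 5 + (x * N + y)) =
        (if in_mono_triangle (matrix_edges N (block_color V p z)) (matrix_color (block_color V p z)) {x, y}
         then 1 else 0)"
  shows "eval w r m update_exp = improve V p z (r 9) (r 10)"
proof -
  let ?x = "r 9 mod s" and ?y = "s + r 10 mod s"
  have lt: "?x < N" "?y < N"
    using N_s mod_less_divisor [of s "r 9"] mod_less_divisor [of s "r 10"] by linarith+
  then have "?x * N + ?y < 2 ^ v"
    using row_col_less [of ?x N ?y] N_fits(1) by linarith
  then have "r 5 + (?x * N + ?y) < 2 ^ w"
    using b by linarith
  moreover have words: "r 9 < 2 ^ w" "r 10 < 2 ^ w"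
    using r n_fits(3) by linarith+
  ultimately have o: "eval w r m (Mem (Bin Add (Reg 5) (Bin Add (Bin Mul (Bin Mod (Reg 9) (Reg 2)) (Reg 1))
      (Bin Add (Reg 2) (Bin Mod (Reg 10) (Reg 2)))))) = m (r 5 + (?x * N + ?y))"
    by (simp add: regs mod_simps del: One_nat_def)
  have c: "eval w r m (Mem (cell (Reg 9) (Reg 10))) = V (r 9) (r 10)" "V (r 9) (r 10) < 2 ^ w"
    using V r by (auto simp: eval_cell regs)
  have e: "eval w r m (even_part (Mem (cell (Reg 9) (Reg 10)))) = 2 * (V (r 9) (r 10) div 2)"
    using c by (subst eval_even_part) simp_all
  show ?thesis
  proof (cases "r 9 div s = z div 25 \<and> r 10 div s = z div 5 mod 5")
    case True
    then have d: "r 9 div s = z div 25" "r 10 div s = z div 5 mod 5"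
      by auto
    have "z div 25 < 2 ^ w"
      using d(1) words(1) div_le_dividend [of "r 9" s] by linarith
    then show ?thesis
      using out [OF lt improve_eq(2) [OF r d]] unfolding update_exp_def Let_def improve_eq(1) [OF r d]
      by (simp add: o c e words z d regs del: eval.simps(4) One_nat_def)
  next
    case False
    then show ?thesis
      unfolding update_exp_def Let_def improve_other [OF r False]
      by (auto simp add: c words z regs simp del: eval.simps(4))
  qed
qed

end

section \<open>Correctness of a single call\<close>

lemma wp_Seq_rule:
  assumes "wp w a t Q s" "\<And>r m. Q (r, m) \<Longrightarrow> wp w b u Q' (r, m)"
  shows "wp w (Seq a b) (t + u) Q' s"
  using wp_Seq [OF wp_mono [OF assms(1)]] assms(2) by blast

lemma filled_in: "i < n \<Longrightarrow> j < n \<Longrightarrow> filled b n f m (b + (i * n + j)) = f i j"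
  using row_col_less [of i n j] by (simp add: filled_def)

lemma filled_out: "y < b \<or> b + n * n \<le> y \<Longrightarrow> filled b n f m y = m y"
  by (auto simp: filled_def)

context reduction
begin

lemma view_cong:
  assumes "view V p r m" "\<And>x. x < 4 \<Longrightarrow> r' x = r x" "\<And>y. y < 3 * (n * n) \<Longrightarrow> m' y = m y"
  shows "view V p r' m'"
proof -
  have "n * n + (i * n + j) < 3 * (n * n)" "2 * (n * n) + (i * n + j) < 3 * (n * n)"
    "i * n + j < 3 * (n * n)" if "i < n" "j < n" for i j
    using row_col_less [OF that] by linarith+
  then show ?thesis
    using assms unfolding view_def by simp
qed

lemma view_filled:
  assumes "view V p r m" "\<And>i j. i < n \<Longrightarrow> j < n \<Longrightarrow> V' i j < 2 ^ w"
    "\<And>x. x < 3 \<Longrightarrow> r' x = r x" "r' 3 = p'"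
  shows "view V' p' r' (filled (2 * (n * n)) n V' m)"
proof -
  have "n * n + (i * n + j) < 2 * (n * n)" "i * n + j < 2 * (n * n)" if "i < n" "j < n" for i j
    using row_col_less [OF that] by linarith+
  then show ?thesis
    using assms unfolding view_def by (simp add: filled_in filled_out)
qed

lemma run_block_color:
  obtains k where "k \<le> nat \<lfloor>T\<rfloor>"
    "halted P ((step v P ^^ k) (init N (row_major N (block_color V p z))))"
    "input_fits v N (row_major N (block_color V p z))"
    "\<And>x y. x < N \<Longrightarrow> y < N \<Longrightarrow> {x, y} \<in> matrix_edges N (block_color V p z) \<Longrightarrow>
      mem ((step v P ^^ k) (init N (row_major N (block_color V p z)))) (x * N + y) =
        (if in_mono_triangle (matrix_edges N (block_color V p z)) (matrix_color (block_color V p z)) {x, y}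
         then 1 else 0)"
  using P_solves [folded N_def, OF graph, of V p z] unfolding graph_input_eq run_within_def
  using that le_nat_floor by blast

lemma wp_block_step:
  assumes L: "layout V p b r m" and z: "r 7 = z" "z < 125"
    and b: "3 * (n * n) \<le> b" "b + 2 * 2 ^ v \<le> 2 ^ w"
  shows "wp w (block_step P R) ((N * N + nat \<lfloor>T\<rfloor> + 1) * block_cost P R)
    (\<lambda>(r', m'). layout (improve V p z) p (b + 2 ^ v) r' m' \<and> r' 7 = z + 1 \<and> r' 11 = r 11) (r, m)"
    (is "wp _ _ _ ?Q _")
proof -
  let ?f = "block_color V p z"
  have vw: "view V p r m" and r: "r 0 = n" "r 1 = N" "r 2 = s" "r 3 = p" "r 4 = 2 ^ v" "r 5 = b"
    and zero: "\<And>y. b \<le> y \<Longrightarrow> m y = 0"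
    using L by (auto simp: layout_def view_def)
  \<comment> \<open>The second window in the bound on \<open>b\<close> is slack: it makes the next
    base address a word, so that advancing register 5 does not wrap.\<close>
  have "0 < (2 :: nat) ^ v"
    by simp
  then have b_less: "b + 2 ^ v < 2 ^ w"
    using b(2) by linarith
  define r1 where "r1 = r(13 := z div 25, 14 := z div 5 mod 5, 15 := z mod 5)"
  define m1 where "m1 = filled b N ?f m"
  obtain k where k: "k \<le> nat \<lfloor>T\<rfloor>" "halted P ((step v P ^^ k) (init N (row_major N ?f)))"
    "input_fits v N (row_major N ?f)"
    and out: "\<And>x y. x < N \<Longrightarrow> y < N \<Longrightarrow> {x, y} \<in> matrix_edges N ?f \<Longrightarrow>
      mem ((step v P ^^ k) (init N (row_major N ?f))) (x * N + y) =
        (if in_mono_triangle (matrix_edges N ?f) (matrix_color ?f) {x, y} then 1 else 0)"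
    using run_block_color by blast
  define \<mu> where "\<mu> = mem ((step v P ^^ k) (init N (row_major N ?f)))"
  \<comment> \<open>The four pieces are proved for every state that satisfies the guarantee of the
    piece before, and are then chained by \<open>wp_Seq_rule\<close>.\<close>
  have last: "wp w (Seq (Assign 5 (Bin Add (Reg 5) (Reg 4))) (Assign 7 (Bin Add (Reg 7) (Num 1)))) 8 ?Q (r', m')"
    if "off_loop r2 r'" "m' = filled (2 * (n * n)) n (improve V p z) m2" "\<forall>x<20. x \<noteq> 8 \<longrightarrow> r2 x = r1' x"
      "off_loop r1 r1'" "\<forall>y. y < b \<or> b + 2 ^ v \<le> y \<longrightarrow> m2 y = m1 y" for r2 r' m' m2 r1'
  proof -
    have reg: "r' x = r1 x" if "x < 20" "x \<notin> {6, 8, 9, 10}" for x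
      using \<open>off_loop r2 r'\<close> \<open>\<forall>x<20. x \<noteq> 8 \<longrightarrow> r2 x = r1' x\<close> \<open>off_loop r1 r1'\<close> that
      by (simp add: off_loop_def)
    have m1: "m1 y = m y" if "y < b \<or> b + N * N \<le> y" for y
      using that by (simp add: m1_def filled_out)
    have "view V p r' m2"
      using vw by (rule view_cong) (use that b in \<open>auto simp: reg r1_def m1\<close>)
    moreover have "improve V p z i j < 2 ^ w" if "i < n" "j < n" for i j
    proof -
      have "improve V p z i j \<le> V i j"
        by (simp add: improve_def)
      then show ?thesis
        using vw that unfolding view_def by (meson le_less_trans)
    qed
    ultimately have "view (improve V p z) p (r'(5 := b + 2 ^ v, 7 := z + 1)) m'"
      unfolding that(2) by (rule view_filled) (use vw in \<open>auto simp: reg r1_def view_def\<close>)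
    moreover have "m' y = 0" if "b + 2 ^ v \<le> y" for y
    proof -
      have "b + N * N \<le> y" "3 * (n * n) \<le> y"
        using that N_fits(1) b(1) by linarith+
      then show ?thesis
        unfolding \<open>m' = _\<close> using \<open>\<forall>y. y < b \<or> b + 2 ^ v \<le> y \<longrightarrow> m2 y = m1 y\<close> that
        by (simp add: filled_out m1 zero)
    qed
    ultimately have "?Q (r'(5 := b + 2 ^ v, 7 := z + 1), m')"
      by (simp add: layout_def reg r1_def r)
    then show ?thesis
      using b_less z by (intro wp_sem) (simp_all add: reg r1_def r)
  qed
  have update: "wp w (fill 0 interval_base update_exp)
      ((n * n + 1) * (elen interval_base + elen update_exp + 22))
      (\<lambda>(r', m'). off_loop r2 r' \<and> m' = filled (2 * (n * n)) n (improve V p z) m2) (r2, m2)"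
    if r2: "\<forall>x<20. x \<noteq> 8 \<longrightarrow> r2 x = r1' x" "off_loop r1 r1'"
      and m2: "\<forall>y. y < b \<or> b + 2 ^ v \<le> y \<longrightarrow> m2 y = m1 y" "\<forall>y<2 ^ v. m2 (b + y) = \<mu> y" for r2 m2 r1'
  proof (rule wp_fill)
    have reg: "r2 x = r1 x" if "x < 20" "x \<notin> {6, 8, 9, 10}" for x
      using r2 that by (simp add: off_loop_def)
    show "r2 0 = n" "n * n < 2 ^ w" "2 * (n * n) + n * n \<le> 2 ^ w"
      using n_fits by (simp_all add: reg r1_def r)
    show "eval w r' m' interval_base = 2 * (n * n)" if "off_loop r2 r'" for r' m'
      using that n_fits by (simp add: off_loop_def interval_base_def reg r1_def r mod_simps)
    show "eval w r' m' update_exp = improve V p z (r' 9) (r' 10)"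
      if o: "off_loop r2 r'" and lt: "r' 9 < n" "r' 10 < n"
        and m': "\<And>y. y < 2 * (n * n) \<or> 2 * (n * n) + r' 9 * n + r' 10 \<le> y \<Longrightarrow> m' y = m2 y" for r' m'
    proof (rule eval_update)
      have reg': "r' x = r1 x" if "x < 20" "x \<notin> {6, 8, 9, 10}" for x
        using o that by (simp add: off_loop_def reg)
      then have b': "r' 5 = b"
        by (simp add: r1_def r)
      show "r' 0 = n" "r' 1 = N" "r' 2 = s" "r' 13 = z div 25" "r' 14 = z div 5 mod 5"
        "r' 5 + 2 ^ v \<le> 2 ^ w"
        using b by (simp_all add: reg' r1_def r del: One_nat_def)
      have "2 * (n * n) + (r' 9 * n + r' 10) < 3 * (n * n)"
        using row_col_less [OF lt] by linarith
      then have "m' (2 * (n * n) + (r' 9 * n + r' 10)) = m (2 * (n * n) + (r' 9 * n + r' 10))"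
        using m' m2(1) b(1) by (simp add: m1_def filled_out)
      then show "m' (2 * (n * n) + (r' 9 * n + r' 10)) = V (r' 9) (r' 10)" "V (r' 9) (r' 10) < 2 ^ w"
        using vw lt by (simp_all add: view_def)
      show "m' (r' 5 + (x * N + y)) =
          (if in_mono_triangle (matrix_edges N ?f) (matrix_color ?f) {x, y} then 1 else 0)"
        if xy: "x < N" "y < N" "{x, y} \<in> matrix_edges N ?f" for x y
      proof -
        have "x * N + y < 2 ^ v"
          using row_col_less [OF xy(1,2)] N_fits(1) by linarith
        \<comment> \<open>The window lies above the interval numbers, so the answers stay intact
          while these are rewritten.\<close>
        moreover have "2 * (n * n) + r' 9 * n + r' 10 \<le> b + (x * N + y)"
          using row_col_less [OF lt] b(1) by linarith
        ultimately show ?thesis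
          using m' m2(2) out [OF xy] unfolding b' \<mu>_def by simp
      qed
    qed (use lt in simp_all)
  qed simp
  have calling: "wp w (call P R) ((k + 1) * call_cost P R)
      (\<lambda>(r', m'). (\<forall>x<20. x \<noteq> 8 \<longrightarrow> r' x = r1' x) \<and>
        (\<forall>y. y < b \<or> b + 2 ^ v \<le> y \<longrightarrow> m' y = m1 y) \<and> (\<forall>y<2 ^ v. m' (b + y) = \<mu> y)) (r1', m1)"
    if "off_loop r1 r1'" for r1'
  proof -
    have r1': "r1' 1 = N" "r1' 4 = 2 ^ v" "r1' 5 = b"
      using that by (simp_all add: off_loop_def r1_def r del: One_nat_def)
    have "m1 (b + y) = (if y < length (row_major N ?f) then row_major N ?f ! y else 0)"
      if "y < 2 ^ v" for y
      using zero by (simp add: m1_def filled_def row_major_def)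
    then show ?thesis
      using wp_call [of r1' v w P R "row_major N ?f" m1 k] P_length P_regs k b r1'
      unfolding r1' \<mu>_def by simp
  qed
  have coloring: "wp w (fill 1 (Reg 5) color_exp) ((N * N + 1) * (elen (Reg 5) + elen color_exp + 22))
      (\<lambda>(r', m'). off_loop r1 r' \<and> m' = m1) (r1, m)"
    unfolding m1_def
  proof (rule wp_fill)
    show "r1 1 = N" "N * N < 2 ^ w" "b + N * N \<le> 2 ^ w"
      using n_fits b N_fits by (simp_all add: r1_def r del: One_nat_def)
    show "eval w r' m' (Reg 5) = b" if "off_loop r1 r'" for r' m'
      using that by (simp add: off_loop_def r1_def r)
    show "eval w r' m' color_exp = ?f (r' 9) (r' 10)"
      if o: "off_loop r1 r'" and "r' 9 < N" "r' 10 < N"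
        and m': "\<And>y. y < b \<or> b + r' 9 * N + r' 10 \<le> y \<Longrightarrow> m' y = m y" for r' m'
    proof (rule eval_color)
      show "view V p r' m'"
        using vw by (rule view_cong) (use o m' b in \<open>auto simp: off_loop_def r1_def\<close>)
    qed (use that z in \<open>auto simp: off_loop_def r1_def\<close>)
  qed simp
  have "wp w (Seq (fill 1 (Reg 5) color_exp) (Seq (call P R) (Seq (fill 0 interval_base update_exp)
      (Seq (Assign 5 (Bin Add (Reg 5) (Reg 4))) (Assign 7 (Bin Add (Reg 7) (Num 1)))))))
    ((N * N + 1) * (elen (Reg 5) + elen color_exp + 22) + ((k + 1) * call_cost P R +
      ((n * n + 1) * (elen interval_base + elen update_exp + 22) + 8))) ?Q (r1, m)"
    apply (rule wp_Seq_rule [OF coloring])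
    apply (clarify)
    apply (rule wp_Seq_rule [OF calling], assumption)
    apply (clarify)
    apply (rule wp_Seq_rule [OF update], assumption+)
    apply (clarify)
    apply (rule last, assumption, rule refl, assumption+)
    done
  moreover have start: "sem w (Assign 15 (Bin Mod (Reg 7) (Num 5))) (sem w (Assign 14 (Bin Mod (Bin Div (Reg 7) (Num 5)) (Num 5)))
      (sem w (Assign 13 (Bin Div (Reg 7) (Num 25))) (r, m))) = (r1, m)"
    using z by (simp add: r1_def)
  ultimately have "wp w (block_step P R)
    (clen (Assign 13 (Bin Div (Reg 7) (Num 25))) + (clen (Assign 14 (Bin Mod (Bin Div (Reg 7) (Num 5)) (Num 5))) + (clen (Assign 15 (Bin Mod (Reg 7) (Num 5))) +
    ((N * N + 1) * (elen (Reg 5) + elen color_exp + 22) + ((k + 1) * call_cost P R +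
      ((n * n + 1) * (elen interval_base + elen update_exp + 22) + 8)))))) ?Q (r, m)"
    unfolding block_step_def start [symmetric] by (intro wp_sem_Seq loop_free.simps(1) [THEN iffD2] TrueI)
  moreover have "clen (Assign 13 (Bin Div (Reg 7) (Num 25))) + (clen (Assign 14 (Bin Mod (Bin Div (Reg 7) (Num 5)) (Num 5))) + (clen (Assign 15 (Bin Mod (Reg 7) (Num 5))) +
    ((N * N + 1) * (elen (Reg 5) + elen color_exp + 22) + ((k + 1) * call_cost P R +
      ((n * n + 1) * (elen interval_base + elen update_exp + 22) + 8))))) \<le>
    (N * N + nat \<lfloor>T\<rfloor> + 1) * block_cost P R"
  proof -
    let ?K = "N * N + nat \<lfloor>T\<rfloor> + 1"
    have "n * n \<le> N * N"
      using N_s by (intro mult_mono) auto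
    then have "(N * N + 1) * (elen (Reg 5) + elen color_exp + 22) \<le> ?K * (elen (Reg 5) + elen color_exp + 22)"
      "(k + 1) * call_cost P R \<le> ?K * call_cost P R"
      "(n * n + 1) * (elen interval_base + elen update_exp + 22) \<le> ?K * (elen interval_base + elen update_exp + 22)"
      using k(1) by (intro mult_le_mono1, linarith)+
    moreover have "22 \<le> ?K * 22"
      by simp
    ultimately show ?thesis
      unfolding block_cost_def add_mult_distrib2 elen.simps clen.simps by linarith
  qed
  ultimately show ?thesis
    using wp_mono by blast
qed

end

section \<open>Rounds of the binary search\<close>

text \<open>A round starts with every entry in the second half of its interval; only a hit moves it
  to the first half.\<close>

definition double_exp :: exp where
  "double_exp = Bin Add (Bin Mul (Num 2) (Mem (cell (Reg 9) (Reg 10)))) (Num 1)"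

definition search_round :: "program \<Rightarrow> nat \<Rightarrow> com" where
  "search_round P R =
     Seq (Assign 3 (Bin Div (Reg 3) (Num 2)))
     (Seq (fill 0 interval_base double_exp)
     (Seq (Assign 7 (Num 0)) (While Less (Reg 7) (Num 125) (block_step P R))))"

definition round_cost :: "program \<Rightarrow> nat \<Rightarrow> nat" where
  "round_cost P R = 125 * block_cost P R + elen interval_base + elen double_exp + 1000"

text \<open>Gives \<open>2 ^ (c * L)\<close> when register 11 contains \<open>2 ^ L\<close>. The
  product can be unrolled because \<open>c\<close> is a constant of the given algorithm.\<close>

fun power_exp :: "nat \<Rightarrow> exp" where
  "power_exp 0 = Num 1"
| "power_exp (Suc c) = Bin Mul (Reg 11) (power_exp c)"

definition result_exp :: exp where
  "result_exp = Cond Less (Mem (cell (Reg 9) (Reg 10))) (Reg 0) (Mem (cell (Reg 9) (Reg 10))) (Reg 0)"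

text \<open>Register 11 becomes the least power of 2 that is at least \<open>N + 2\<close>. This is
  the rounding in \<open>word_length\<close>, so the word length of the given program is reproduced
  without computing a logarithm. The same power exceeds \<open>n\<close> and is the initial interval
  length.\<close>

definition min_witness_com :: "program \<Rightarrow> nat \<Rightarrow> nat \<Rightarrow> com" where
  "min_witness_com P R c =
     Seq (Assign 1 (Cond Less (Reg 0) (Num 3) (Num 3) (Reg 0)))
     (Seq (Assign 2 (Bin Div (Reg 1) (Num 3)))
     (Seq (Assign 11 (Num 1))
     (Seq (While Less (Reg 11) (Bin Add (Reg 1) (Num 2)) (Assign 11 (Bin Mul (Num 2) (Reg 11))))
     (Seq (Assign 4 (power_exp c))
     (Seq (Assign 5 (Bin Mul (Num 3) (Reg 4)))
     (Seq (Assign 3 (Reg 11))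
     (Seq (While Less (Num 1) (Reg 3) (search_round P R))
       (fill 0 (Num 0) result_exp))))))))"

definition min_witness_cost :: "program \<Rightarrow> nat \<Rightarrow> nat \<Rightarrow> nat" where
  "min_witness_cost P R c = round_cost P R + elen (power_exp c) + elen result_exp + 100"

lemma wp_Assign_Seq:
  "wp w b u Q (r(x := eval w r m e), m) \<Longrightarrow> wp w (Seq (Assign x e) b) (elen e + 1 + u) Q (r, m)"
  using wp_sem_Seq [of "Assign x e" w b u Q "(r, m)"] by simp

context reduction
begin

text \<open>Closed form of the entries in the middle of a round: \<open>V\<close> before the round,
  doubled and then improved by the calls with numbers below \<open>z\<close>.\<close>

definition partial :: "(nat \<Rightarrow> nat \<Rightarrow> nat) \<Rightarrow> nat \<Rightarrow> nat \<Rightarrow> nat \<Rightarrow> nat \<Rightarrow> nat" where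
  "partial V p z i j = 2 * V i j +
     (if \<exists>k<n. A i k \<and> B k j \<and> k div p = 2 * V i j \<and>
           25 * (i div s) + 5 * (j div s) + k div s < z
      then 0 else 1)"

lemma partial_0: "partial V p 0 i j = 2 * V i j + 1"
  by (simp add: partial_def)

text \<open>A hit changes only the parity of an entry, so all calls of a round test the same
  interval.\<close>

lemma improve_partial: "improve (partial V p z) p z = partial V p (Suc z)"
proof (intro ext)
  fix i j
  have "partial V p z i j div 2 = V i j"
    by (simp add: partial_def)
  then show "improve (partial V p z) p z i j = partial V p (Suc z) i j"
    unfolding improve_def partial_def less_Suc_eq by auto
qed

text \<open>The numbers of the block triples go up to \<open>25 * 4 + 5 * 4 + 4 = 124\<close>, so
  after all calls the restriction on the blocks disappears.\<close>

lemma partial_125: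
  assumes "i < n" "j < n"
  shows "partial V p 125 i j =
    2 * V i j + (if \<exists>k<n. (A i k \<and> B k j) \<and> k div p = 2 * V i j then 0 else 1)"
proof -
  have "25 * (i div s) + 5 * (j div s) + k div s < 125" if "k < n" for k
    using div_s_less [OF assms(1)] div_s_less [OF assms(2)] div_s_less [OF that] by linarith
  then show ?thesis
    unfolding partial_def by (metis (no_types, lifting))
qed

text \<open>Of the 126 windows, 125 belong to the calls and one is the slack required by
  \<open>wp_block_step\<close>.\<close>

lemma wp_search_round:
  assumes L: "layout V (2 * p) b r m"
    and V: "\<And>i j. i < n \<Longrightarrow> j < n \<Longrightarrow> 2 * V i j + 1 < 2 ^ w" and p: "2 * p < 2 ^ w"
    and b: "3 * (n * n) \<le> b" "b + 126 * 2 ^ v \<le> 2 ^ w"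
  shows "wp w (search_round P R) ((N * N + nat \<lfloor>T\<rfloor> + 1) * round_cost P R)
    (\<lambda>(r', m'). layout (partial V p 125) p (b + 125 * 2 ^ v) r' m' \<and> r' 11 = r 11) (r, m)"
    (is "wp _ _ _ ?Q _")
proof -
  let ?K = "N * N + nat \<lfloor>T\<rfloor> + 1"
  have vw: "view V (2 * p) r m" and r: "r 0 = n" "r 1 = N" "r 2 = s" "r 3 = 2 * p" "r 4 = 2 ^ v" "r 5 = b"
    and zero: "\<And>y. b \<le> y \<Longrightarrow> m y = 0"
    using L by (auto simp: layout_def view_def)
  define r1 where "r1 = r(3 := p)"
  define m1 where "m1 = filled (2 * (n * n)) n (partial V p 0) m"
  have loop: "wp w (While Less (Reg 7) (Num 125) (block_step P R))
      (125 * (?K * block_cost P R + (elen (Reg 7) + elen (Num 125) + 3)) + (elen (Reg 7) + elen (Num 125) + 3))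
      ?Q (r', m')"
    if r': "layout (partial V p 0) p b r' m'" "r' 7 = 0" "r' 11 = r 11" for r' m'
  proof (rule wp_While [where Inv = "\<lambda>z (r', m'). layout (partial V p z) p (b + z * 2 ^ v) r' m' \<and>
        r' 7 = z \<and> r' 11 = r 11"])
    fix z r' m'
    assume z: "z < 125" and inv: "case (r', m') of (r', m') \<Rightarrow>
      layout (partial V p z) p (b + z * 2 ^ v) r' m' \<and> r' 7 = z \<and> r' 11 = r 11"
    have "z * 2 ^ v \<le> 124 * 2 ^ v"
      using z by (intro mult_le_mono1) simp
    then have "b + z * 2 ^ v + 2 * 2 ^ v \<le> 2 ^ w" "3 * (n * n) \<le> b + z * 2 ^ v"
      using b by linarith+
    with wp_block_step [of "partial V p z" p "b + z * 2 ^ v" r' m' z] z inv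
    have "wp w (block_step P R) (?K * block_cost P R)
        (\<lambda>(r', m'). layout (partial V p (Suc z)) p (b + z * 2 ^ v + 2 ^ v) r' m' \<and> r' 7 = z + 1 \<and> r' 11 = r 11)
        (r', m')"
      by (simp add: improve_partial)
    then show "holds Less (eval w r' m' (Reg 7)) (eval w r' m' (Num 125)) \<and>
      wp w (block_step P R) (?K * block_cost P R) (\<lambda>(r', m'). layout (partial V p (Suc z)) p (b + Suc z * 2 ^ v) r' m' \<and>
        r' 7 = Suc z \<and> r' 11 = r 11) (r', m')"
      using z inv by (simp add: add_ac)
  qed (use that in auto)
  have double: "wp w (fill 0 interval_base double_exp)
      ((n * n + 1) * (elen interval_base + elen double_exp + 22))
      (\<lambda>(r', m'). off_loop r1 r' \<and> m' = m1) (r1, m)"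
    unfolding m1_def
  proof (rule wp_fill)
    show "r1 0 = n" "n * n < 2 ^ w" "2 * (n * n) + n * n \<le> 2 ^ w"
      using n_fits by (simp_all add: r1_def r)
    show "eval w r' m' interval_base = 2 * (n * n)" if "off_loop r1 r'" for r' m'
      using that n_fits by (simp add: off_loop_def interval_base_def r1_def r mod_simps)
    show "eval w r' m' double_exp = partial V p 0 (r' 9) (r' 10)"
      if o: "off_loop r1 r'" and lt: "r' 9 < n" "r' 10 < n"
        and m': "\<And>y. y < 2 * (n * n) \<or> 2 * (n * n) + r' 9 * n + r' 10 \<le> y \<Longrightarrow> m' y = m y" for r' m'
    proof -
      have "r' 0 = n"
        using o by (simp add: off_loop_def r1_def r)
      moreover have "m' (2 * (n * n) + (r' 9 * n + r' 10)) = V (r' 9) (r' 10)"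
        using m' vw lt by (simp add: view_def)
      ultimately show ?thesis
        using lt V [OF lt] by (simp add: double_exp_def eval_cell partial_0 mod_simps)
    qed
  qed simp
  have "wp w (Seq (fill 0 interval_base double_exp)
       (Seq (Assign 7 (Num 0)) (While Less (Reg 7) (Num 125) (block_step P R))))
     ((n * n + 1) * (elen interval_base + elen double_exp + 22) + (elen (Num 0) + 1 +
       (125 * (?K * block_cost P R + (elen (Reg 7) + elen (Num 125) + 3)) + (elen (Reg 7) + elen (Num 125) + 3))))
     ?Q (r1, m)"
  proof (rule wp_Seq_rule [OF double], clarify, rule wp_Assign_Seq, rule loop)
    fix r'
    assume o: "off_loop r1 r'"
    have "view (partial V p 0) p (r'(7 := 0)) m1"
      unfolding m1_def using vw
      by (rule view_filled) (use V o in \<open>auto simp: partial_0 off_loop_def r1_def\<close>)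
    moreover have "m1 y = 0" if "b \<le> y" for y
      using that b(1) zero by (simp add: m1_def filled_out)
    ultimately show "layout (partial V p 0) p b (r'(7 := eval w r' m1 (Num 0))) m1"
      using o by (simp add: layout_def off_loop_def r1_def r)
    show "(r'(7 := eval w r' m1 (Num 0))) 11 = r 11"
      using o by (simp add: off_loop_def r1_def)
  qed simp
  moreover have "r(3 := eval w r m (Bin Div (Reg 3) (Num 2))) = r1"
    using p by (simp add: r1_def r)
  ultimately have run: "wp w (search_round P R) (elen (Bin Div (Reg 3) (Num 2)) + 1 +
     ((n * n + 1) * (elen interval_base + elen double_exp + 22) + (elen (Num 0) + 1 +
       (125 * (?K * block_cost P R + (elen (Reg 7) + elen (Num 125) + 3)) + (elen (Reg 7) + elen (Num 125) + 3)))))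
     ?Q (r, m)" (is "wp _ _ ?t _ _")
    unfolding search_round_def by (intro wp_Assign_Seq) simp
  have "?t \<le> ?K * round_cost P R"
  proof -
    have "n * n \<le> N * N"
      using N_s by (intro mult_mono) auto
    then have "(n * n + 1) * (elen interval_base + elen double_exp + 22) \<le>
        ?K * (elen interval_base + elen double_exp + 22)"
      by (intro mult_le_mono1) linarith
    moreover have "900 \<le> ?K * 900"
      by simp
    ultimately show ?thesis
      unfolding round_cost_def add_mult_distrib2 elen.simps by linarith
  qed
  with run show ?thesis
    using wp_mono by blast
qed

end

lemma nth_row_major: "i < n \<Longrightarrow> j < n \<Longrightarrow> row_major n f ! (i * n + j) = f i j"
  using row_col_less [of i n j] by (simp add: row_major_def)

lemma length_row_major [simp]: "length (row_major n f) = n * n"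
  by (simp add: row_major_def)

context reduction
begin

abbreviation input :: "nat list" where
  "input \<equiv> matrices_input n A B"

lemma wp_search_rounds:
  assumes L: "layout (\<lambda>i j. 0) (2 ^ L) (3 * 2 ^ v) r m"
    and n_less: "n < 2 ^ L" and w: "L + 1 < w" and room: "(129 + 125 * L) * 2 ^ v \<le> (2 :: nat) ^ w"
  shows "wp w (While Less (Num 1) (Reg 3) (search_round P R))
    (L * ((N * N + nat \<lfloor>T\<rfloor> + 1) * round_cost P R + (elen (Num 1) + elen (Reg 3) + 3)) +
      (elen (Num 1) + elen (Reg 3) + 3))
    (\<lambda>(r', m'). \<exists>V. view V 1 r' m' \<and>
      (\<forall>i<n. \<forall>j<n. search n (\<lambda>k. A i k \<and> B k j) 1 (V i j))) (r, m)"
\<comment> \<open>The last conjunct says that after \<open>l\<close> rounds the interval numbers are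
  below \<open>2 ^ l\<close>, which keeps doubling from wrapping. In \<open>3 + 125 * l\<close>, the
  3 stands for the space of the matrices and 125 for the windows used up by each round.\<close>
proof (rule wp_While [where Inv = "\<lambda>l (r', m'). \<exists>V. layout V (2 ^ (L - l)) ((3 + 125 * l) * 2 ^ v) r' m' \<and>
    (\<forall>i<n. \<forall>j<n. search n (\<lambda>k. A i k \<and> B k j) (2 ^ (L - l)) (V i j) \<and>
      (V i j + 1) * 2 ^ (L - l) \<le> 2 ^ L)"])
  show "case (r, m) of (r', m') \<Rightarrow> \<exists>V. layout V (2 ^ (L - 0)) ((3 + 125 * 0) * 2 ^ v) r' m' \<and>
    (\<forall>i<n. \<forall>j<n. search n (\<lambda>k. A i k \<and> B k j) (2 ^ (L - 0)) (V i j) \<and>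
      (V i j + 1) * 2 ^ (L - 0) \<le> 2 ^ L)"
    using L n_less by (auto intro!: exI [of _ "\<lambda>i j. 0"] search_init)
next
  fix l r' m'
  assume l: "l < L" and "case (r', m') of (r', m') \<Rightarrow> \<exists>V. layout V (2 ^ (L - l)) ((3 + 125 * l) * 2 ^ v) r' m' \<and>
    (\<forall>i<n. \<forall>j<n. search n (\<lambda>k. A i k \<and> B k j) (2 ^ (L - l)) (V i j) \<and>
      (V i j + 1) * 2 ^ (L - l) \<le> 2 ^ L)"
  then obtain V where lay: "layout V (2 ^ (L - l)) ((3 + 125 * l) * 2 ^ v) r' m'"
    and V: "\<And>i j. i < n \<Longrightarrow> j < n \<Longrightarrow> search n (\<lambda>k. A i k \<and> B k j) (2 ^ (L - l)) (V i j)"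
      "\<And>i j. i < n \<Longrightarrow> j < n \<Longrightarrow> (V i j + 1) * 2 ^ (L - l) \<le> 2 ^ L"
    by auto
  let ?p = "2 ^ (L - Suc l) :: nat"
  have p: "2 ^ (L - l) = 2 * ?p" "1 \<le> ?p"
    using l by (simp_all flip: power_Suc add: Suc_diff_Suc)
  have "2 ^ (L - l) \<le> (2 :: nat) ^ L" and L_less: "(2 :: nat) ^ L < 2 ^ w"
    using w by simp_all
  then have p_less: "2 * ?p < 2 ^ w"
    unfolding p(1) [symmetric] by linarith
  have V_less: "2 * V i j + 1 < 2 ^ w" if "i < n" "j < n" for i j
  proof -
    have "2 * (V i j + 1) \<le> 2 * (V i j + 1) * ?p"
      using mult_le_mono2 [OF p(2), of "2 * (V i j + 1)"] unfolding mult_1_right .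
    also have "\<dots> \<le> 2 ^ L"
      using V(2) [OF that] by (simp add: p(1) mult_ac)
    also have "\<dots> < 2 ^ w"
      by (rule L_less)
    finally show ?thesis
      by simp
  qed
  have "(3 + 125 * l) * 2 ^ v + 126 * 2 ^ v = (129 + 125 * l) * 2 ^ v"
    by (simp add: algebra_simps)
  also have "\<dots> \<le> (129 + 125 * L) * 2 ^ v"
    using l by (intro mult_le_mono1) simp
  finally have b: "(3 + 125 * l) * 2 ^ v + 126 * 2 ^ v \<le> 2 ^ w"
    using room by linarith
  have "3 * 2 ^ v \<le> (3 + 125 * l) * 2 ^ v"
    by (intro mult_le_mono1) simp
  then have low: "3 * (n * n) \<le> (3 + 125 * l) * 2 ^ v"
    using n_fits(1) by linarith
  have round: "wp w (search_round P R) ((N * N + nat \<lfloor>T\<rfloor> + 1) * round_cost P R)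
      (\<lambda>(r2, m2). layout (partial V ?p 125) ?p ((3 + 125 * l) * 2 ^ v + 125 * 2 ^ v) r2 m2 \<and> r2 11 = r' 11)
      (r', m')"
    by (rule wp_search_round [OF lay [unfolded p(1)] _ p_less low b]) (rule V_less)
  have "wp w (search_round P R) ((N * N + nat \<lfloor>T\<rfloor> + 1) * round_cost P R)
      (\<lambda>(r', m'). \<exists>V. layout V ?p ((3 + 125 * Suc l) * 2 ^ v) r' m' \<and>
        (\<forall>i<n. \<forall>j<n. search n (\<lambda>k. A i k \<and> B k j) ?p (V i j) \<and>
          (V i j + 1) * ?p \<le> 2 ^ L)) (r', m')"
  proof (rule wp_mono [OF round], clarify)
    fix r2 m2
    assume r2: "layout (partial V ?p 125) ?p ((3 + 125 * l) * 2 ^ v + 125 * 2 ^ v) r2 m2"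
    have "(partial V ?p 125 i j + 1) * ?p \<le> 2 ^ L" if "i < n" "j < n" for i j
    proof -
      have "(partial V ?p 125 i j + 1) * ?p \<le> (2 * (V i j + 1)) * ?p"
        by (intro mult_le_mono1) (simp add: partial_def)
      also have "\<dots> \<le> 2 ^ L"
        using V(2) [OF that] by (simp add: p(1) mult_ac)
      finally show ?thesis .
    qed
    moreover have "search n (\<lambda>k. A i k \<and> B k j) ?p (partial V ?p 125 i j)" if "i < n" "j < n" for i j
      unfolding partial_125 [OF that] by (rule search_step [OF V(1) [OF that, unfolded p(1)]])
    moreover have "(3 + 125 * l) * 2 ^ v + 125 * 2 ^ v = (3 + 125 * Suc l) * 2 ^ v"
      by (simp add: algebra_simps)
    ultimately show "\<exists>V. layout V ?p ((3 + 125 * Suc l) * 2 ^ v) r2 m2 \<and>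
        (\<forall>i<n. \<forall>j<n. search n (\<lambda>k. A i k \<and> B k j) ?p (V i j) \<and> (V i j + 1) * ?p \<le> 2 ^ L)"
      using r2 by (intro exI [of _ "partial V ?p 125"]) simp
  qed simp_all
  moreover have "holds Less (eval w r' m' (Num 1)) (eval w r' m' (Reg 3))"
  proof -
    have "r' 3 = 2 ^ (L - l)"
      using lay by (simp add: layout_def view_def)
    moreover have "1 < (2 :: nat) ^ (L - l)"
      using l by (intro one_less_power) simp_all
    ultimately show ?thesis
      by simp
  qed
  ultimately show "holds Less (eval w r' m' (Num 1)) (eval w r' m' (Reg 3)) \<and>
      wp w (search_round P R) ((N * N + nat \<lfloor>T\<rfloor> + 1) * round_cost P R)
      (\<lambda>(r', m'). \<exists>V. layout V ?p ((3 + 125 * Suc l) * 2 ^ v) r' m' \<and>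
        (\<forall>i<n. \<forall>j<n. search n (\<lambda>k. A i k \<and> B k j) ?p (V i j) \<and>
          (V i j + 1) * ?p \<le> 2 ^ L)) (r', m')"
    by blast
qed (auto simp: layout_def view_def)

lemma eval_power_exp:
  assumes "r 11 = 2 ^ L" "c * L < w"
  shows "eval w r m (power_exp c) = 2 ^ (c * L)"
  using assms(2)
proof (induction c)
  case (Suc c)
  then have "eval w r m (power_exp c) = 2 ^ (c * L)"
    by simp
  then show ?case
    using Suc.prems by (simp add: assms(1) flip: power_add)
qed simp

lemma wp_min_witness:
  assumes L: "N + 2 \<le> 2 ^ L" "\<And>i. i < L \<Longrightarrow> 2 ^ i < N + 2"
    and v: "v = c * L" "v < w" and w: "L + 1 < w"
    and room: "(129 + 125 * L) * 2 ^ v \<le> (2 :: nat) ^ w"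
  shows "wp w (min_witness_com P R c) ((L + 1) * (N * N + nat \<lfloor>T\<rfloor> + 1) * min_witness_cost P R c)
    (\<lambda>(r', m'). \<forall>i<n. \<forall>j<n. m' (i * n + j) = witness_word n (min_witness n A B i j))
    ((\<lambda>_. 0)(0 := n), \<lambda>a. if a < length input then input ! a else 0)"
    (is "wp _ _ _ ?Q (?r, ?m)")
proof -
  let ?K = "N * N + nat \<lfloor>T\<rfloor> + 1"
  define r1 where "r1 = ?r(1 := N, 2 := s)"
  define r2 where "r2 = r1(11 := 2 ^ L, 4 := 2 ^ v, 5 := 3 * 2 ^ v, 3 := 2 ^ L)"
  have len: "length input = 2 * (n * n)"
    by (simp add: matrices_input_def)
  \<comment> \<open>The interval numbers need no initialization: the memory behind the input is
    zero, and 0 is the only interval number at length \<open>2 ^ L\<close>.\<close>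
  have "view (\<lambda>i j. 0) (2 ^ L) r2 ?m"
    unfolding view_def
  proof (intro conjI allI impI)
    fix i j
    assume ij: "i < n" "j < n"
    note lt = row_col_less [OF ij]
    show "?m (i * n + j) = of_bool (A i j)" "?m (n * n + (i * n + j)) = of_bool (B i j)"
      "?m (2 * (n * n) + (i * n + j)) = 0"
      using lt ij by (simp_all add: matrices_input_def nth_append nth_row_major)
  qed (simp_all add: r2_def r1_def)
  moreover have "?m y = 0" if "3 * 2 ^ v \<le> y" for y
    using that n_fits(1) len by simp
  ultimately have lay: "layout (\<lambda>i j. 0) (2 ^ L) (3 * 2 ^ v) r2 ?m"
    by (simp add: layout_def r2_def)
  have result: "wp w (fill 0 (Num 0) result_exp) ((n * n + 1) * (elen (Num 0) + elen result_exp + 22)) ?Q (r, m)"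
    if vw: "view V 1 r m" and V: "\<forall>i<n. \<forall>j<n. search n (\<lambda>k. A i k \<and> B k j) 1 (V i j)" for V r m
  proof -
    have "wp w (fill 0 (Num 0) result_exp) ((n * n + 1) * (elen (Num 0) + elen result_exp + 22))
        (\<lambda>(r', m'). off_loop r r' \<and> m' = filled 0 n (\<lambda>i j. witness_word n (min_witness n A B i j)) m) (r, m)"
    proof (rule wp_fill)
      show "r 0 = n" "n * n < 2 ^ w" "0 + n * n \<le> 2 ^ w"
        using vw n_fits by (simp_all add: view_def)
      show "eval w r' m' result_exp = witness_word n (min_witness n A B (r' 9) (r' 10))"
        if o: "off_loop r r'" and lt: "r' 9 < n" "r' 10 < n"
          and m': "\<And>y. y < 0 \<or> 0 + r' 9 * n + r' 10 \<le> y \<Longrightarrow> m' y = m y" for r' m'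
      proof -
        have "r' 0 = n"
          using o vw by (simp add: off_loop_def view_def)
        \<comment> \<open>The output overwrites the input, but the interval numbers lie beyond the
          cells written so far.\<close>
        moreover have "r' 9 * n + r' 10 \<le> 2 * (n * n) + (r' 9 * n + r' 10)"
          by simp
        then have "m' (2 * (n * n) + (r' 9 * n + r' 10)) = V (r' 9) (r' 10)"
          using m' vw lt by (simp add: view_def)
        ultimately have "eval w r' m' result_exp = min (V (r' 9) (r' 10)) n"
          using lt by (simp add: result_exp_def eval_cell min_def)
        also have "\<dots> = witness_word n (min_witness n A B (r' 9) (r' 10))"
          using V lt by (intro search_final) simp
        finally show ?thesis .
      qed
    qed simp_all
    then show ?thesis
      by (rule wp_mono) (auto simp: filled_in [where b = 0, simplified])
  qed
  have tail: "wp w (Seq (Assign 4 (power_exp c))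
     (Seq (Assign 5 (Bin Mul (Num 3) (Reg 4)))
     (Seq (Assign 3 (Reg 11))
     (Seq (While Less (Num 1) (Reg 3) (search_round P R))
       (fill 0 (Num 0) result_exp)))))
     (elen (power_exp c) + 1 + (elen (Bin Mul (Num 3) (Reg 4)) + 1 + (elen (Reg 11) + 1 +
       (L * (?K * round_cost P R + (elen (Num 1) + elen (Reg 3) + 3)) + (elen (Num 1) + elen (Reg 3) + 3) +
        (n * n + 1) * (elen (Num 0) + elen result_exp + 22))))) ?Q (r1(11 := 2 ^ L), ?m)"
  proof (intro wp_Assign_Seq, rule wp_Seq_rule [OF wp_search_rounds])
    have "3 * 2 ^ v < (2 :: nat) ^ w"
      using w_large(1) zero_less_power [of "2 :: nat" v] by linarith
    then have "r1(11 := 2 ^ L, 4 := eval w (r1(11 := 2 ^ L)) ?m (power_exp c),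
       5 := eval w (r1(11 := 2 ^ L, 4 := eval w (r1(11 := 2 ^ L)) ?m (power_exp c))) ?m (Bin Mul (Num 3) (Reg 4)),
       3 := eval w (r1(11 := 2 ^ L, 4 := eval w (r1(11 := 2 ^ L)) ?m (power_exp c),
         5 := eval w (r1(11 := 2 ^ L, 4 := eval w (r1(11 := 2 ^ L)) ?m (power_exp c))) ?m (Bin Mul (Num 3) (Reg 4))))
         ?m (Reg 11)) = r2"
      using v by (simp add: eval_power_exp [where L = L] r2_def)
    with lay show "layout (\<lambda>i j. 0) (2 ^ L) (3 * 2 ^ v) (r1(11 := 2 ^ L, 4 := eval w (r1(11 := 2 ^ L)) ?m (power_exp c),
       5 := eval w (r1(11 := 2 ^ L, 4 := eval w (r1(11 := 2 ^ L)) ?m (power_exp c))) ?m (Bin Mul (Num 3) (Reg 4)),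
       3 := eval w (r1(11 := 2 ^ L, 4 := eval w (r1(11 := 2 ^ L)) ?m (power_exp c),
         5 := eval w (r1(11 := 2 ^ L, 4 := eval w (r1(11 := 2 ^ L)) ?m (power_exp c))) ?m (Bin Mul (Num 3) (Reg 4))))
         ?m (Reg 11))) ?m"
      by simp
    show "n < 2 ^ L"
      using L(1) N_s(4) by linarith
  qed (use w room result in auto)
  have logarithm: "wp w (While Less (Reg 11) (Bin Add (Reg 1) (Num 2)) (Assign 11 (Bin Mul (Num 2) (Reg 11))))
      (L * (clen (Assign 11 (Bin Mul (Num 2) (Reg 11))) + (elen (Reg 11) + elen (Bin Add (Reg 1) (Num 2)) + 3)) +
        (elen (Reg 11) + elen (Bin Add (Reg 1) (Num 2)) + 3))
      (\<lambda>(r', m'). r' = r1(11 := 2 ^ L) \<and> m' = ?m) (r1(11 := 1), ?m)"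
  proof (rule wp_While [where Inv = "\<lambda>i (r', m'). r' = r1(11 := 2 ^ i) \<and> m' = ?m"])
    have "(2 :: nat) ^ L < 2 ^ w"
      using w by simp
    then have N2: "(N + 2) mod 2 ^ w = N + 2"
      by (rule mod_less [OF le_less_trans [OF L(1)]])
    fix r' m'
    {
      fix i
      assume i: "i < L" and "case (r', m') of (r', m') \<Rightarrow> r' = r1(11 := 2 ^ i) \<and> m' = ?m"
      moreover have "2 * (2 :: nat) ^ i < 2 ^ w"
        using i w by (simp flip: power_Suc)
      ultimately show "holds Less (eval w r' m' (Reg 11)) (eval w r' m' (Bin Add (Reg 1) (Num 2))) \<and>
          wp w (Assign 11 (Bin Mul (Num 2) (Reg 11))) (clen (Assign 11 (Bin Mul (Num 2) (Reg 11))))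
            (\<lambda>(r', m'). r' = r1(11 := 2 ^ Suc i) \<and> m' = ?m) (r', m')"
        using L(2) [OF i] N2 by (auto simp: r1_def intro!: wp_sem)
    }
    show "\<not> holds Less (eval w r' m' (Reg 11)) (eval w r' m' (Bin Add (Reg 1) (Num 2))) \<and>
        (case (r', m') of (r', m') \<Rightarrow> r' = r1(11 := 2 ^ L) \<and> m' = ?m)"
      if "case (r', m') of (r', m') \<Rightarrow> r' = r1(11 := 2 ^ L) \<and> m' = ?m"
      using that L(1) N2 by (auto simp: r1_def)
  qed simp
  let ?e1 = "Cond Less (Reg 0) (Num 3) (Num 3) (Reg 0)" and ?e2 = "Bin Div (Reg 1) (Num 3)"
  have start: "?r(1 := eval w ?r ?m ?e1, 2 := eval w (?r(1 := eval w ?r ?m ?e1)) ?m ?e2,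
      11 := eval w (?r(1 := eval w ?r ?m ?e1, 2 := eval w (?r(1 := eval w ?r ?m ?e1)) ?m ?e2)) ?m (Num 1)) =
    r1(11 := 1)"
    using n_fits(5) by (auto simp: r1_def s_def N_def max_def)
  have run: "wp w (min_witness_com P R c) (elen ?e1 + 1 + (elen ?e2 + 1 + (elen (Num 1) + 1 +
      (L * (clen (Assign 11 (Bin Mul (Num 2) (Reg 11))) + (elen (Reg 11) + elen (Bin Add (Reg 1) (Num 2)) + 3)) +
        (elen (Reg 11) + elen (Bin Add (Reg 1) (Num 2)) + 3) +
      (elen (power_exp c) + 1 + (elen (Bin Mul (Num 3) (Reg 4)) + 1 + (elen (Reg 11) + 1 +
       (L * (?K * round_cost P R + (elen (Num 1) + elen (Reg 3) + 3)) + (elen (Num 1) + elen (Reg 3) + 3) +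
        (n * n + 1) * (elen (Num 0) + elen result_exp + 22))))))))) ?Q (?r, ?m)" (is "wp _ _ ?t _ _")
    unfolding min_witness_com_def
    by (intro wp_Assign_Seq, unfold start, rule wp_Seq_rule [OF logarithm]) (use tail in auto)
  have "?t \<le> (L + 1) * ?K * min_witness_cost P R c"
  proof -
    let ?LK = "(L + 1) * ?K"
    have "n * n \<le> N * N"
      using N_s by (intro mult_mono) auto
    then have "n * n + 1 \<le> ?K"
      by linarith
    moreover have "L + 1 \<le> ?LK" "L * ?K \<le> ?LK" "?K \<le> ?LK"
      by simp_all
    ultimately have "(n * n + 1) * (elen result_exp + 23) \<le> ?LK * (elen result_exp + 23)"
      "L * ?K * round_cost P R \<le> ?LK * round_cost P R" "(L + 1) * 60 \<le> ?LK * 60"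
      "1 * elen (power_exp c) \<le> ?LK * elen (power_exp c)"
      by (intro mult_le_mono1, linarith)+
    then show ?thesis
      unfolding min_witness_cost_def add_mult_distrib2 elen.simps clen.simps by (simp add: algebra_simps)
  qed
  with run show ?thesis
    using wp_mono by blast
qed

end

section \<open>Word length and running time\<close>

lemma finite_evars [simp]: "finite (evars e)"
  by (induction e) auto

lemma finite_cvars [simp]: "finite (cvars a)"
  by (induction a) auto

lemma finite_instr_regs [simp]: "finite (instr_regs a)"
  by (cases a) auto

definition ceil_log :: "nat \<Rightarrow> nat" where
  "ceil_log n = nat \<lceil>log 2 (real n + 2)\<rceil>"

text \<open>Replaces the rounded real logarithm by a comparison of natural numbers, in the form in
  which the program finds \<open>2 ^ L\<close>.\<close>

lemma ceil_log_le_iff: "ceil_log n \<le> l \<longleftrightarrow> n + 2 \<le> 2 ^ l"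
proof -
  have "ceil_log n \<le> l \<longleftrightarrow> log 2 (real n + 2) \<le> real l"
    by (simp add: ceil_log_def nat_le_iff ceiling_le_iff)
  also have "\<dots> \<longleftrightarrow> real n + 2 \<le> 2 powr real l"
    by (simp add: log_le_iff)
  also have "\<dots> \<longleftrightarrow> real (n + 2) \<le> real (2 ^ l)"
    by (simp add: powr_realpow add.commute)
  finally show ?thesis
    unfolding of_nat_le_iff .
qed

text \<open>For \<open>n < 3\<close> the calls work on three vertices, so their word length is
  determined by 3 instead of \<open>n\<close>; the factor 2 makes up for this.\<close>

lemma ceil_log_bounds:
  assumes "0 < n"
  shows "2 \<le> ceil_log n" "ceil_log (max n 3) \<le> 2 * ceil_log n"
proof -
  have "\<not> ceil_log n \<le> 1"
    using assms unfolding ceil_log_le_iff by simp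
  then show "2 \<le> ceil_log n"
    by simp
  show "ceil_log (max n 3) \<le> 2 * ceil_log n"
  proof (cases "n < 3")
    case True
    then have "ceil_log (max n 3) \<le> 3"
      unfolding ceil_log_le_iff by simp
    then show ?thesis
      using \<open>2 \<le> ceil_log n\<close> by linarith
  qed simp
qed

lemma word_length_ceil_log: "word_length c n = c * ceil_log n"
  by (simp add: word_length_def ceil_log_def)

text \<open>In the constant of the word length, \<open>c\<close> pays for the words of the
  interpreted program and \<open>length P\<close> for its program counter. The 10 pays for the
  number of windows, which takes at most \<open>8 + L\<close> bits, and for the numerals; the factor
  2 comes from \<open>ceil_log_bounds\<close>.\<close>

lemma reduction_runs:
  fixes A B :: "nat \<Rightarrow> nat \<Rightarrow> bool"
  assumes n: "0 < n" and R: "\<And>a. a \<in> set P \<Longrightarrow> instr_regs a \<subseteq> {..<R}"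
    and P: "\<And>E col. edge_colored_graph (max n 3) E col \<Longrightarrow>
      run_within (word_length c (max n 3)) P (max n 3) (graph_input (max n 3) E col) T
        (\<lambda>m. \<forall>x<max n 3. \<forall>y<max n 3. {x, y} \<in> E \<longrightarrow>
          m (x * max n 3 + y) = (if in_mono_triangle E col {x, y} then 1 else 0))"
    and d: "cvars (min_witness_com P R c) \<subseteq> {..<d}"
    and t: "real ((ceil_log (max n 3) + 1) * (max n 3 * max n 3 + nat \<lfloor>T\<rfloor> + 1) * min_witness_cost P R c) \<le> t"
  shows "run_within (word_length (2 * (c + 10 + length P)) n) (ccode d 0 (min_witness_com P R c)) n
    (matrices_input n A B) t
    (\<lambda>m. \<forall>i<n. \<forall>j<n. m (i * n + j) = witness_word n (min_witness n A B i j))"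
proof -
  define l L v w where "l = ceil_log n" and "L = ceil_log (max n 3)" and "v = word_length c (max n 3)"
    and "w = word_length (2 * (c + 10 + length P)) n"
  note l = ceil_log_bounds [OF n, folded l_def L_def]
  have v: "v = c * L"
    by (simp add: v_def L_def word_length_ceil_log)
  have "c * L \<le> c * (2 * l)" "length P * 1 \<le> length P * (2 * l)"
    using l by (intro mult_le_mono2; simp)+
  moreover have "w = c * (2 * l) + 20 * l + length P * (2 * l)"
    by (simp add: w_def l_def word_length_ceil_log algebra_simps)
  ultimately have w: "v + 20 * l + length P \<le> w"
    unfolding v by linarith
  have pow: "2 ^ a \<le> (2 :: nat) ^ w" if "a \<le> w" for a
    using that by simp
  interpret reduction n w v R P A B T
  proof
    show "length P < 2 ^ w"
      using less_exp [of "length P"] pow [of "length P"] w by linarith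
    show "4 * 2 ^ v \<le> (2 :: nat) ^ w"
      using pow [of "v + 2"] w l(1) by (simp add: power_add)
    show "128 \<le> (2 :: nat) ^ w"
      using pow [of 7] w l(1) by simp
  qed (use n R P in \<open>auto simp: v_def\<close>)
  have room: "(129 + 125 * L) * 2 ^ v \<le> (2 :: nat) ^ w"
  proof -
    have "129 + 125 * L \<le> 256 * 2 ^ L"
      using less_exp [of L] by linarith
    then have "(129 + 125 * L) * 2 ^ v \<le> 256 * 2 ^ L * 2 ^ v"
      by (rule mult_le_mono1)
    also have "\<dots> = 2 ^ (8 + L + v)"
      by (simp add: power_add)
    also have "\<dots> \<le> 2 ^ w"
      using w l by (intro pow) linarith
    finally show ?thesis .
  qed
  have "N + 2 \<le> 2 ^ L" "\<And>i. i < L \<Longrightarrow> 2 ^ i < N + 2"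
    using ceil_log_le_iff [of N] by (auto simp: L_def N_def simp flip: not_le)
  moreover have "v < w" "L + 1 < w"
    using w l by linarith+
  ultimately obtain k s where k: "k \<le> (L + 1) * (N * N + nat \<lfloor>T\<rfloor> + 1) * min_witness_cost P R c"
    and run: "runs w (min_witness_com P R c) k
      ((\<lambda>_. 0)(0 := n), \<lambda>a. if a < length input then input ! a else 0) s"
    and result: "\<forall>i<n. \<forall>j<n. snd s (i * n + j) = witness_word n (min_witness n A B i j)"
    using wp_min_witness [of L c] v room unfolding wp_def by auto
  have bits: "x < 2 ^ w" if "x \<in> set input" for x
  proof -
    have "x \<le> 1"
      using that by (auto simp: matrices_input_def row_major_def)
    then show ?thesis
      using n_fits(3) by linarith
  qed
  have "words w ((\<lambda>_. 0)(0 := n))" "words w (\<lambda>a. if a < length input then input ! a else 0)"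
    using n_fits bits by (auto simp: words_def)
  from runs_halts [OF run d this] obtain k' where k': "k' \<le> k"
    "halted (ccode d 0 (min_witness_com P R c)) ((step w (ccode d 0 (min_witness_com P R c)) ^^ k') (init n input))"
    "mem ((step w (ccode d 0 (min_witness_com P R c)) ^^ k') (init n input)) = snd s"
    unfolding init_def by blast
  have "k' \<le> (L + 1) * (N * N + nat \<lfloor>T\<rfloor> + 1) * min_witness_cost P R c"
    using k k'(1) by linarith
  then have "real k' \<le> t"
    using t unfolding L_def N_def by (meson of_nat_le_iff order_trans)
  moreover have "input_fits w n input"
    using n_fits bits by (simp add: input_fits_def matrices_input_def)
  ultimately show ?thesis
    using k' result unfolding run_within_def w_def by metis
qed

text \<open>Replacing \<open>n + 2\<close> by \<open>2 * n\<close>, rounding up and the summand 1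
  cost at most 1 each, and \<open>1 \<le> log 2 n\<close> absorbs these 3.\<close>

lemma ceil_log_le_log:
  assumes "3 \<le> n"
  shows "real (ceil_log n + 1) \<le> 4 * log 2 (real n)"
proof -
  have "1 \<le> log 2 (real n)"
    using assms by (subst le_log_iff) auto
  have "real (ceil_log n) \<le> log 2 (real n + 2) + 1"
  proof -
    have "0 \<le> log 2 (real n + 2)"
      by (subst zero_le_log_cancel_iff) auto
    then show ?thesis
      unfolding ceil_log_def by linarith
  qed
  also have "log 2 (real n + 2) \<le> log 2 (2 * real n)"
    using assms by (subst log_le_cancel_iff) auto
  also have "\<dots> = 1 + log 2 (real n)"
    using assms by (simp add: log_mult)
  finally show ?thesis
    using \<open>1 \<le> log 2 (real n)\<close> by simp
qed

theorem theorem2: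
  fixes T :: "nat \<Rightarrow> real"
  assumes "AE_Mono_Triangle_in_time T"
  shows "\<exists>T'. T' \<in> O(\<lambda>n. T n * log 2 (real n)) \<and> MinWitness_in_time T'"
proof -
  obtain P c where P: "\<And>n E col. 0 < n \<Longrightarrow> edge_colored_graph n E col \<Longrightarrow>
      run_within (word_length c n) P n (graph_input n E col) (T n)
        (\<lambda>m. \<forall>u<n. \<forall>v<n. {u, v} \<in> E \<longrightarrow>
          m (u * n + v) = (if in_mono_triangle E col {u, v} then 1 else 0))"
    using assms unfolding AE_Mono_Triangle_in_time_def by blast
  \<comment> \<open>The bounds \<open>R\<close> and \<open>d\<close> depend on \<open>P\<close> and
    \<open>c\<close> alone, so a single compiled program serves all \<open>n\<close>.\<close>
  have "finite (\<Union>a\<in>set P. instr_regs a)"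
    by simp
  then obtain R where R: "\<And>a. a \<in> set P \<Longrightarrow> instr_regs a \<subseteq> {..<R}"
    unfolding finite_nat_iff_bounded by blast
  define C where "C = min_witness_cost P R c"
  obtain d where d: "cvars (min_witness_com P R c) \<subseteq> {..<d}"
    using finite_cvars finite_nat_iff_bounded by blast
  \<comment> \<open>The 16 is the product of the 4 from \<open>ceil_log_le_log\<close> and the 4 in
    \<open>N * N + T N + 1 \<le> 4 * T N\<close>. With \<open>max n 3\<close> the bound is also
    valid at small \<open>n\<close>, where for instance \<open>log 2 1 = 0\<close>; asymptotically
    the maximum is \<open>n\<close>.\<close>
  define T' where "T' n = 16 * real C * (T (max n 3) * log 2 (real (max n 3)))" for n
  have "T' \<in> O(\<lambda>n. T n * log 2 (real n))"
  proof (rule bigoI)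
    show "eventually (\<lambda>n. norm (T' n) \<le> (16 * real C) * norm (T n * log 2 (real n))) at_top"
      using eventually_ge_at_top [of 3] by eventually_elim (simp add: T'_def abs_mult)
  qed
  moreover have "MinWitness_in_time T'"
    unfolding MinWitness_in_time_def
  proof (intro exI allI impI)
    fix n :: nat and A B
    assume n: "0 < n"
    let ?N = "max n 3"
    have N: "3 \<le> ?N"
      by simp
    then have "real (?N * (?N - 1)) \<le> T ?N"
      by (intro AE_Mono_Triangle_lower_bound [OF P]) auto
    moreover have "?N * ?N + 1 \<le> 3 * (?N * (?N - 1))"
    proof -
      obtain k where "?N = k + 3"
        using N le_Suc_ex by (metis add.commute)
      then show ?thesis
        by (simp add: algebra_simps)
    qed
    ultimately have quad: "real (?N * ?N + 1) \<le> 3 * T ?N"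
      by linarith
    then have pos: "0 \<le> T ?N"
      by linarith
    then have "real (nat \<lfloor>T ?N\<rfloor>) \<le> T ?N"
      by linarith
    with quad have K: "real (?N * ?N + nat \<lfloor>T ?N\<rfloor> + 1) \<le> 4 * T ?N"
      unfolding of_nat_add by linarith
    have "real ((ceil_log ?N + 1) * (?N * ?N + nat \<lfloor>T ?N\<rfloor> + 1) * C) =
        real (ceil_log ?N + 1) * real (?N * ?N + nat \<lfloor>T ?N\<rfloor> + 1) * real C"
      by (simp only: of_nat_mult)
    also have "\<dots> \<le> (4 * log 2 (real ?N)) * (4 * T ?N) * real C"
      using ceil_log_le_log [OF N] K pos by (intro mult_mono mult_nonneg_nonneg) auto
    also have "\<dots> = T' n"
      by (simp add: T'_def)
    finally have bound: "real ((ceil_log ?N + 1) * (?N * ?N + nat \<lfloor>T ?N\<rfloor> + 1) *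
        min_witness_cost P R c) \<le> T' n"
      unfolding C_def .
    have "0 < ?N"
      using N by linarith
    from reduction_runs [OF n R P [OF this] d bound]
    show "run_within (word_length (2 * (c + 10 + length P)) n)
        (ccode d 0 (min_witness_com P R c)) n (matrices_input n A B) (T' n)
        (\<lambda>m. \<forall>i<n. \<forall>j<n. m (i * n + j) = witness_word n (min_witness n A B i j))" .
  qed
  ultimately show ?thesis
    by blast
qed

end
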